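(* Let $q\in\mathbb{N}^+$ and let $G=(V,E)$ be a (possibly infinite) $(q+1)$-regular graph. Let $\rho>q^{1/2}$ and let $h$ be holomorphic on $\Omega(\rho)$. Then for every $v\in V$, $$\int_{\mathbb{R}} h(x)\, d\mu_G^v(x)=\int_{\mathbb{R}} h(x)\, d\mu_q(x)+\sum_{r=1}^{\infty}q^{-r/2}a_{r,q}(h)\,f_r(v;G),$$ where $a_{r,q}(h)=(1+q^{-1})\int_{-2}^{2}h(x)X_{r,q}(x)\,d\mu_q(x)$.
   Context: Graphs: $G=(V,E)$ is undirected and may have multiple edges and loops. Each edge gives two directed edges, each the inverse $\bar e$ of the other. $(q+1)$-regular means every vertex is the origin of exactly $q+1$ directed edges; the adjacency operator $A$ on $\ell^2(V)$ has $A_{ab}$ equal to the number of directed edges from $a$ to $b$. A walk of length $n$ is a sequence of directed edges $e_0,\dots,e_{n-1}$ with $t(e_i)=o(e_{i+1})$; it is non-backtracking if $e_{i+1}\ne\bar e_i$ for all $i$; it is closed if it starts and ends at the same vertex. $f_r(v;G)$ is the number of closed non-backtracking walks of length $r$ starting and ending at $v$. $\mu_G^v$ is the spectral measure of the self-adjoint operator $q^{-1/2}A$ at the unit vector $\mathbf 1_v$, i.e. the probability measure with $\int P\,d\mu_G^v=\langle\mathbf 1_v,P(q^{-1/2}A)\mathbf 1_v\rangle$ for all polynomials $P$. $X_{r,q}$ are defined by $\frac{1-q^{-1}t^2}{1-xt+t^2}=\sum_{r\ge0}X_{r,q}(x)t^r$. Kesten–McKay distribution: $d\mu_1(x)=\frac{1}{\pi\sqrt{4-x^2}}\mathbf{1}_{|x|\le2}dx$,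 and for $q>1$, $d\mu_q(x)=\frac{1}{2\pi}\frac{(q+1)\sqrt{4-x^2}}{(q^{1/2}+q^{-1/2})^2-x^2}\mathbf{1}_{|x|\le 2}dx$. $\Omega(\rho)=\{w\in\mathbb{C}: \frac{(\mathrm{Re}\,w)^2}{(\rho+\rho^{-1})^2}+\frac{(\mathrm{Im}\,w)^2}{(\rho-\rho^{-1})^2}<1\}$.
   Formalization: The factor (1+q^{-1}) in a_{r,q}(h) is replaced by its inverse (1+q^{-1})^{-1}; as printed the formula fails: for q=1, one vertex with one loop, h(x)=x, the left side is 2 and the right side is 8. *)

theory Defs
  imports
    "HOL-Complex_Analysis.Complex_Analysis"
    "HOL-Probability.Probability"
    "HOL-Computational_Algebra.Computational_Algebra"
    "Graph_Theory.Graph_Theory"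
begin

text \<open>
  An undirected graph with multiple edges and loops is given by its directed edges
  \<^term>\<open>arcs G\<close> together with the inversion \<open>arev\<close>, which is a fixed-point-free involution
  on the directed edges (so a loop contributes two directed edges). That \<open>arev\<close> is the
  identity outside \<^term>\<open>arcs G\<close> is a mere normalisation.  Since \<open>card\<close> of an infinite set
  is \<open>0\<close>, the degree condition forces finite degrees when \<open>d > 0\<close>.
\<close>

definition regular_graph :: "('v, 'e) pre_digraph \<Rightarrow> ('e \<Rightarrow> 'e) \<Rightarrow> nat \<Rightarrow> bool" where
  "regular_graph G arev d \<longleftrightarrow>
     bidirected_digraph G arev \<and> (\<forall>v\<in>verts G. out_degree G v = d)"

definition non_backtracking :: "('e \<Rightarrow> 'e) \<Rightarrow> 'e awalk \<Rightarrow> bool" where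
  "non_backtracking arev p \<longleftrightarrow> (\<forall>i. Suc i < length p \<longrightarrow> p ! Suc i \<noteq> arev (p ! i))"

definition num_closed_nb_walks ::
    "('v, 'e) pre_digraph \<Rightarrow> ('e \<Rightarrow> 'e) \<Rightarrow> nat \<Rightarrow> 'v \<Rightarrow> nat" where
  "num_closed_nb_walks G arev r v =
     card {p. pre_digraph.awalk G v p v \<and> length p = r \<and> non_backtracking arev p}"

definition adj_entry :: "('v, 'e) pre_digraph \<Rightarrow> 'v \<Rightarrow> 'v \<Rightarrow> nat" where
  "adj_entry G a b = card {e \<in> arcs G. tail G e = a \<and> head G e = b}"

text \<open>
  Elements of \<open>\<ell>\<^sup>2(V)\<close> are functions \<open>'v \<Rightarrow> complex\<close> vanishing outside \<^term>\<open>verts G\<close>.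
  The operators below are only applied to finitely supported vectors, and in a graph with
  finite degrees they preserve finite support.
\<close>

definition adj_op :: "('v, 'e) pre_digraph \<Rightarrow> ('v \<Rightarrow> complex) \<Rightarrow> ('v \<Rightarrow> complex)" where
  "adj_op G f = (\<lambda>a. if a \<in> verts G
                      then \<Sum>\<^sub>\<infinity>b\<in>verts G. of_nat (adj_entry G a b) * f b else 0)"

definition scaled_adj_op ::
    "nat \<Rightarrow> ('v, 'e) pre_digraph \<Rightarrow> ('v \<Rightarrow> complex) \<Rightarrow> ('v \<Rightarrow> complex)" where
  "scaled_adj_op q G f = (\<lambda>a. of_real (1 / sqrt (real q)) * adj_op G f a)"

definition ell2_inner :: "'v set \<Rightarrow> ('v \<Rightarrow> complex) \<Rightarrow> ('v \<Rightarrow> complex) \<Rightarrow> complex" where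
  "ell2_inner V f g = (\<Sum>\<^sub>\<infinity>x\<in>V. cnj (f x) * g x)"

definition op_poly ::
    "complex poly \<Rightarrow> (('v \<Rightarrow> complex) \<Rightarrow> ('v \<Rightarrow> complex)) \<Rightarrow> ('v \<Rightarrow> complex) \<Rightarrow> ('v \<Rightarrow> complex)"
  where "op_poly P T f = (\<lambda>x. \<Sum>i\<le>degree P. coeff P i * (T ^^ i) f x)"

definition is_spectral_measure ::
    "nat \<Rightarrow> ('v, 'e) pre_digraph \<Rightarrow> 'v \<Rightarrow> real measure \<Rightarrow> bool" where
  "is_spectral_measure q G v \<mu> \<longleftrightarrow>
     prob_space \<mu> \<and> sets \<mu> = sets borel \<and>
     (\<forall>P. integrable \<mu> (\<lambda>x. poly P (complex_of_real x)) \<and>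
          (\<integral>x. poly P (complex_of_real x) \<partial>\<mu>) =
            ell2_inner (verts G) (indicator {v})
              (op_poly P (scaled_adj_op q G) (indicator {v})))"

definition spectral_measure ::
    "nat \<Rightarrow> ('v, 'e) pre_digraph \<Rightarrow> 'v \<Rightarrow> real measure" where
  "spectral_measure q G v = (THE \<mu>. is_spectral_measure q G v \<mu>)"

definition X_fun :: "nat \<Rightarrow> nat \<Rightarrow> real \<Rightarrow> real" where
  "X_fun r q x =
     fps_nth ((1 - fps_const (1 / real q) * fps_X ^ 2) /
              (1 - fps_const x * fps_X + fps_X ^ 2)) r"

definition kesten_mckay_density :: "nat \<Rightarrow> real \<Rightarrow> real" where
  "kesten_mckay_density q x =
     (if \<bar>x\<bar> \<le> 2 then
        if q = 1 then 1 / (pi * sqrt (4 - x\<^sup>2))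
        else 1 / (2 * pi) * ((real q + 1) * sqrt (4 - x\<^sup>2) /
               ((sqrt (real q) + 1 / sqrt (real q))\<^sup>2 - x\<^sup>2))
      else 0)"

definition kesten_mckay :: "nat \<Rightarrow> real measure" where
  "kesten_mckay q = density lborel (\<lambda>x. ennreal (kesten_mckay_density q x))"

definition Omega :: "real \<Rightarrow> complex set" where
  "Omega \<rho> = {w. (Re w)\<^sup>2 / (\<rho> + 1 / \<rho>)\<^sup>2 + (Im w)\<^sup>2 / (\<rho> - 1 / \<rho>)\<^sup>2 < 1}"

text \<open>
  The functions \<open>X_fun r q\<close> are orthogonal for the Kesten--McKay distribution, and for
  \<open>r \<ge> 1\<close> the integral of \<open>(X_fun r q)\<^sup>2\<close> is \<open>1 + 1/q\<close>; the expansion coefficient of \<open>h\<close>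
  is therefore normalised by the \<^emph>\<open>inverse\<close> of \<open>1 + 1/q\<close>.  The factor \<open>1 + 1/q\<close> without
  the inverse, as printed in the source, is a misprint that makes the formula false: take
  \<open>q = 1\<close>, one vertex with one loop, and \<open>h(x) = x\<close>; then the left-hand side is \<open>2\<close>
  and the right-hand side would be \<open>8\<close>.
\<close>

definition a_coeff :: "nat \<Rightarrow> nat \<Rightarrow> (complex \<Rightarrow> complex) \<Rightarrow> complex" where
  "a_coeff r q h =
     of_real (inverse (1 + 1 / real q)) *
       (LINT x:{-2..2}|kesten_mckay q. h (of_real x) * of_real (X_fun r q x))"

text \<open>
  A function \<open>h\<close> on \<^term>\<open>Omega \<rho>\<close> is represented by a total function with unspecified,
  possibly non-measurable values elsewhere, so integrals over \<open>\<real>\<close> are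
  taken over the real points of \<^term>\<open>Omega \<rho>\<close>.
\<close>

definition Omega_real :: "real \<Rightarrow> real set" where
  "Omega_real \<rho> = {x. complex_of_real x \<in> Omega \<rho>}"

end

theory Submission
  imports Defs
begin

text \<open>
  Let \<open>L(P) = \<langle>1\<^sub>v, P(T) 1\<^sub>v\<rangle>\<close> with \<open>T = q\<^sup>-\<^sup>1\<^sup>/\<^sup>2 A\<close> and \<open>R = q\<^sup>1\<^sup>/\<^sup>2 + q\<^sup>-\<^sup>1\<^sup>/\<^sup>2\<close>. Since \<open>\<plusminus>T \<le> R\<close>, the functional
  \<open>L\<close> is nonnegative on the polynomials \<open>(R + x)\<^sup>k (R - x)\<^sup>l\<close>, so by Hausdorff's solution of the moment
  problem it is integration against a probability measure on \<open>[-R, R]\<close>; this is the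
  spectral measure. Counting non-backtracking walks by their first arc gives the recursion of
  the \<open>X\<^sub>r\<close>, hence \<open>L(X\<^sub>r) = q\<^sup>-\<^sup>r\<^sup>/\<^sup>2 f\<^sub>r(v)\<close>.

  It remains to expand \<open>h\<close> in the \<open>X\<^sub>r\<close>, uniformly on \<open>[-R, R]\<close>. Substituting \<open>w = z + 1/z\<close> in the
  Cauchy integral of \<open>h\<close> over an ellipse turns the Cauchy kernel into
  \<open>(1 - z\<^sup>2) / (1 - x z + z\<^sup>2)\<close> on a circle \<open>|z| = \<tau> < q\<^sup>-\<^sup>1\<^sup>/\<^sup>2\<close>, which is the generating function of the \<open>X\<^sub>r\<close>
  times a factor independent of \<open>x\<close>. Moving the circle to \<open>|z| = 1\<close>, where \<open>z + 1/z = 2 cos t\<close>,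
  identifies the coefficients with the Kesten--McKay integrals \<open>a\<^sub>r(h)\<close>.
\<close>

section \<open>The Hausdorff moment problem\<close>

text \<open>The bound R on the spectrum cannot be lowered: on a finite graph the constant function
  has eigenvalue R. So h must be expanded on all of [-R, R], which for q > 1 is larger than the
  support [-2, 2] of the Kesten-McKay distribution. On [-R, R] the X_r may grow like (r+1) q^(r/2),
  while the coefficients are O(\<tau>^r) for each radius \<tau> between 1/\<rho> and 1. The
  hypothesis \<rho> > sqrt q leaves room for a radius with 1/\<rho> < \<tau> < 1/sqrt q, and then
  the product is summable. The coefficients do not depend on the radius: a small circle shows their
  decay, the unit circle shows what they are.

  Only finitely supported vectors occur, so each inner product is a finite sum. The estimate |<f, T
  f>| \<le> R <f, f> gives positivity of L on a square times one factor R + x or R - x; higher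
  powers are reduced to this by absorbing even powers into the square.

  The spectral measure is introduced by a definite description, so its moments must also determine
  it. This follows from bounded support through characteristic functions.\<close>

lemma sum_choose_mult_binomial:
  fixes a b :: "'a::comm_semiring_1"
  assumes "m \<le> n"
  shows "(\<Sum>k\<le>n. of_nat ((n choose k) * (k choose m)) * (a ^ k * b ^ (n - k)))
         = of_nat (n choose m) * (a ^ m * (a + b) ^ (n - m))"
proof -
  have "(\<Sum>k\<le>n. of_nat ((n choose k) * (k choose m)) * (a ^ k * b ^ (n - k)))
        = (\<Sum>k\<in>{m..n}. of_nat ((n choose k) * (k choose m)) * (a ^ k * b ^ (n - k)))"
    by (rule sum.mono_neutral_right) (auto simp: binomial_eq_0)
  also have "\<dots> = (\<Sum>j\<le>n-m. of_nat ((n choose (j+m)) * ((j+m) choose m)) * (a ^ (j+m) * b ^ (n - (j+m))))"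
    by (rule sum.reindex_bij_witness[of _ "\<lambda>j. j + m" "\<lambda>k. k - m"]) (use assms in auto)
  also have "\<dots> = (\<Sum>j\<le>n-m. of_nat (n choose m) * (a ^ m * (of_nat ((n - m) choose j) * a ^ j * b ^ (n - m - j))))"
  proof (rule sum.cong[OF refl])
    fix j assume "j \<in> {..n-m}"
    hence "(n choose (j+m)) * ((j+m) choose m) = (n choose m) * ((n - m) choose j)"
      using choose_mult[of m "j+m" n] assms by simp
    moreover have "n - (j + m) = n - m - j" by simp
    ultimately show "of_nat ((n choose (j+m)) * ((j+m) choose m)) * (a ^ (j+m) * b ^ (n - (j+m)))
      = of_nat (n choose m) * (a ^ m * (of_nat ((n - m) choose j) * a ^ j * b ^ (n - m - j)))"
      by (simp add: power_add algebra_simps)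
  qed
  also have "\<dots> = of_nat (n choose m) * (a ^ m * (a + b) ^ (n - m))"
    by (simp add: binomial_ring sum_distrib_left)
  finally show ?thesis .
qed

text \<open>The ratio is a product of m factors (k-i)/(n-i). These and k/n have modulus at most 1
  and differ by at most m/(n-m), so the products differ by at most m times as much. The assumption
  2m < n covers k < i, where |k-i| < n-i.\<close>

lemma choose_ratio_approx:
  fixes k n m :: nat
  assumes "k \<le> n" "2 * m < n"
  shows "\<bar>real (k choose m) / real (n choose m) - (real k / real n) ^ m\<bar> \<le> real m * real m / (real n - real m)"
proof -
  have eq: "real (k choose m) / real (n choose m) = (\<Prod>i<m. (real k - real i) / (real n - real i))"
  proof -
    have "real (k choose m) / real (n choose m) = (real (k choose m) * fact m) / (real (n choose m) * fact m)"
      by simp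
    also have "\<dots> = (\<Prod>i<m. real k - real i) / (\<Prod>i<m. real n - real i)"
      by (simp only: binomial_gbinomial gbinomial_mult_fact' atLeast0LessThan)
    finally show ?thesis by (simp add: prod_dividef)
  qed
  have eq2: "(real k / real n) ^ m = (\<Prod>i<m. real k / real n)" by simp
  have b: "norm ((real k - real i) / (real n - real i) - real k / real n) \<le> real m / (real n - real m)"
    if "i < m" for i
  proof -
    have "(real k - real i) / (real n - real i) - real k / real n = - (real i * (real n - real k)) / (real n * (real n - real i))"
      using assms that by (simp add: field_simps)
    also have "norm \<dots> = (real i / (real n - real i)) * ((real n - real k) / real n)"
      using assms that by (simp add: abs_mult)
    also have "\<dots> \<le> (real m / (real n - real m)) * 1"
      by (rule mult_mono; (rule frac_le)?) (use assms that in \<open>auto simp: field_simps\<close>)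
    finally show ?thesis by simp
  qed
  have "norm ((\<Prod>i<m. (real k - real i) / (real n - real i)) - (\<Prod>i<m. real k / real n))
      \<le> (\<Sum>i<m. norm ((real k - real i) / (real n - real i) - real k / real n))"
    by (rule norm_prod_diff) (use assms in \<open>auto simp: field_simps abs_le_iff\<close>)
  also have "\<dots> \<le> (\<Sum>i<m. real m / (real n - real m))"
    by (rule sum_mono) (use b in auto)
  finally show ?thesis unfolding eq eq2 by simp
qed

section \<open>Linear functionals on real polynomials and their representing measures\<close>

locale poly_functional =
  fixes L :: "real poly \<Rightarrow> real"
  assumes L_add: "L (P + Q) = L P + L Q"
    and L_smult: "L (smult c P) = c * L P"
begin

lemma L_0: "L 0 = 0"
  using L_smult[of 0 0] by simp

lemma L_sum: "L (sum f A) = (\<Sum>x\<in>A. L (f x))"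
  by (induction A rule: infinite_finite_induct) (auto simp: L_0 L_add)

lemma L_of_nat_mult: "L (of_nat n * P) = of_nat n * L P"
  by (simp add: of_nat_poly L_smult)

lemma L_altdef: "L P = (\<Sum>i\<le>degree P. coeff P i * L (monom 1 i))"
proof -
  have "L P = L (\<Sum>i\<le>degree P. smult (coeff P i) (monom 1 i))"
    by (simp add: smult_monom poly_as_sum_of_monoms)
  thus ?thesis by (simp add: L_sum L_smult)
qed

text \<open>The numbers \<open>w n k\<close> are the values of L on the Bernstein basis of degree n,
  hence probability weights. Placed at the points k/n they form laws on [0, 1] whose m-th moments
  tend to L(x^m), so any weak limit of a subsequence is a solution.\<close>

theorem hausdorff_moment_unit:
  assumes one: "L 1 = 1" and pos: "\<And>k l. 0 \<le> L ([:0,1:] ^ k * [:1,-1:] ^ l)"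
  shows "\<exists>M. real_distribution M \<and> (AE x in M. x \<in> {0..1}) \<and> (\<forall>m. (\<integral>x. x ^ m \<partial>M) = L (monom 1 m))"
proof -
  define w where "w n k = real (n choose k) * L ([:0,1:] ^ k * [:1,-1:] ^ (n - k))" for n k
  have w_nonneg: "0 \<le> w n k" for n k unfolding w_def using pos by simp
  \<comment> \<open>Binomial moments are exact for every n \<ge> m, as the sum collapses to L(x^m (x
    + (1-x))^(n-m)). Only the passage to the powers (k/n)^m costs an error.\<close>
  have w_choose: "(\<Sum>k\<le>n. w n k * real (k choose m)) = real (n choose m) * L (monom 1 m)" if "m \<le> n" for n m
  proof -
    have "(\<Sum>k\<le>n. w n k * real (k choose m)) = 
       L (\<Sum>k\<le>n. of_nat ((n choose k) * (k choose m)) * ([:0,1:] ^ k * [:1,-1:] ^ (n - k)))"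
      unfolding L_sum L_of_nat_mult by (simp add: w_def algebra_simps)
    also have "\<dots> = real (n choose m) * L ([:0,1:] ^ m * ([:0,1:] + [:1,-1:]) ^ (n - m))"
      by (simp only: sum_choose_mult_binomial[OF that] L_of_nat_mult)
    also have "[:0,1:] + [:1,-1:] = (1::real poly)" by simp
    finally show ?thesis by (simp add: monom_altdef)
  qed
  have w_sum: "(\<Sum>k\<le>n. w n k) = 1" for n
    using w_choose[of 0 n] one by (simp only: monom_eq_1 binomial_n_0) simp

  define \<mu> where "\<mu> n = distr (point_measure {..n} (\<lambda>k. ennreal (w n k))) borel (\<lambda>k. real k / real n)" for n
  have int\<mu>: "(\<integral>x. f x \<partial>\<mu> n) = (\<Sum>k\<le>n. w n k * f (real k / real n))"
    if [measurable]: "f \<in> borel_measurable borel" for f :: "real \<Rightarrow> real" and n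
    unfolding \<mu>_def 
    by (subst integral_distr) (auto simp: lebesgue_integral_point_measure_finite w_nonneg)
  have dist: "real_distribution (\<mu> n)" for n
  proof -
    have "prob_space (point_measure {..n} (\<lambda>k. ennreal (w n k)))"
      by (rule prob_spaceI) (simp add: space_point_measure emeasure_point_measure_finite w_nonneg w_sum sum_ennreal)
    hence "prob_space (\<mu> n)" unfolding \<mu>_def by (rule prob_space.prob_space_distr) simp
    thus ?thesis by (simp add: real_distribution_def real_distribution_axioms_def \<mu>_def)
  qed
  have frac01: "real k / real n \<in> {0..1}" if "k \<le> n" for k n
    using that by (cases "n = 0") auto
  have "tight \<mu>"
    unfolding tight_def
  proof safe
    fix \<epsilon> :: real assume e: "\<epsilon> > 0"
    \<comment> \<open>Tightness uses intervals open on the left; starting at -1 keeps a possible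
      atom at 0 inside.\<close>
    have "measure (\<mu> n) {-1<..1} > 1 - \<epsilon>" for n
    proof -
      interpret real_distribution "\<mu> n" by (rule dist)
      have "measure (\<mu> n) {-1<..1} = (\<integral>x. indicator {-1<..1} x \<partial>\<mu> n)" by simp
      also have "\<dots> = (\<Sum>k\<le>n. w n k * indicator {-1<..1} (real k / real n))" by (rule int\<mu>) simp
      also have "\<dots> = (\<Sum>k\<le>n. w n k)"
      proof (rule sum.cong[OF refl])
        fix k assume "k \<in> {..n}"
        hence "real k / real n \<in> {-1<..1}" using frac01[of k n] order.strict_trans2[of "-1" 0 "real k / real n"] by auto
        thus "w n k * indicator {-1<..1} (real k / real n) = w n k" by simp
      qed
      finally show ?thesis using w_sum e by simp
    qed
    thus "\<exists>a b. a < b \<and> (\<forall>n. 1 - \<epsilon> < measure (\<mu> n) {a<..b})" by (intro exI[of _ "-1"] exI[of _ 1]) auto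
  qed (rule dist)
  then obtain r M where r: "strict_mono (r :: nat \<Rightarrow> nat)" and M: "real_distribution M"
    and conv: "weak_conv_m (\<mu> \<circ> id \<circ> r) M"
    using tight_imp_convergent_subsubsequence[of \<mu> id] strict_mono_id by blast
  interpret M: real_distribution M by (rule M)
  have lim: "(\<lambda>n. \<Sum>k\<le>r n. w (r n) k * f (real k / real (r n))) \<longlonglongrightarrow> (\<integral>x. f x \<partial>M)"
    if cont: "\<And>x. isCont f x" and bd: "\<And>x. norm (f x) \<le> B" for f :: "real \<Rightarrow> real" and B
  proof -
    have "(\<lambda>n. integral\<^sup>L ((\<mu> \<circ> id \<circ> r) n) f) \<longlonglongrightarrow> integral\<^sup>L M f"
      by (rule weak_conv_imp_integral_bdd_continuous_conv[OF _ M conv cont bd]) (simp add: dist)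
    moreover have "f \<in> borel_measurable borel"
      by (rule borel_measurable_continuous_onI) (simp add: cont continuous_at_imp_continuous_on)
    ultimately show ?thesis by (simp add: int\<mu>)
  qed
  have ae: "AE x in M. x \<in> {0..1}"
  proof -
    \<comment> \<open>A bounded continuous test function with zero set exactly [0, 1]. Its integral
      vanishes along the sequence, hence in the limit.\<close>
    define f :: "real \<Rightarrow> real" where "f x = min 1 (max 0 (max (-x) (x - 1)))" for x
    have f0: "f x \<ge> 0" for x by (simp add: f_def)
    have contf: "isCont f x" for x unfolding f_def by (intro continuous_intros)
    have "(\<lambda>n. \<Sum>k\<le>r n. w (r n) k * f (real k / real (r n))) \<longlonglongrightarrow> (\<integral>x. f x \<partial>M)"
      by (rule lim[of f 1, OF contf]) (simp add: f_def)
    moreover have "(\<Sum>k\<le>r n. w (r n) k * f (real k / real (r n))) = 0" for n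
    proof (intro sum.neutral ballI)
      fix k assume "k \<in> {..r n}"
      hence "f (real k / real (r n)) = 0" using frac01[of k "r n"] by (simp add: f_def)
      thus "w (r n) k * f (real k / real (r n)) = 0" by simp
    qed
    ultimately have "(\<integral>x. f x \<partial>M) = 0" using LIMSEQ_unique[OF _ tendsto_const] by auto
    moreover have "integrable M f"
    proof (rule M.integrable_const_bound[of _ 1])
      show "AE x in M. norm (f x) \<le> 1" by (rule AE_I2) (simp add: f_def)
      have "f \<in> borel_measurable borel"
        by (rule borel_measurable_continuous_onI) (simp add: contf continuous_at_imp_continuous_on)
      thus "f \<in> borel_measurable M" by simp
    qed
    ultimately have "AE x in M. f x = 0" using integral_nonneg_eq_0_iff_AE[of M f] f0 by auto
    thus ?thesis by eventually_elim (auto simp: f_def min_def max_def split: if_splits)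
  qed
  have "(\<integral>x. x ^ m \<partial>M) = L (monom 1 m)" for m
  proof -
    \<comment> \<open>Weak convergence needs bounded test functions, so x^m is clamped outside
      [0, 1].\<close>
    define c :: "real \<Rightarrow> real" where "c x = max 0 (min 1 x) ^ m" for x
    have c: "c x = x ^ m" if "x \<in> {0..1}" for x using that by (auto simp: c_def)
    have 1: "(\<lambda>n. \<Sum>k\<le>r n. w (r n) k * c (real k / real (r n))) \<longlonglongrightarrow> (\<integral>x. c x \<partial>M)"
      by (rule lim[of _ 1]) (auto simp: c_def intro!: continuous_intros power_le_one)
    have 2: "(\<lambda>n. \<Sum>k\<le>n. w n k * c (real k / real n)) \<longlonglongrightarrow> L (monom 1 m)"
    proof (rule LIM_zero_cancel, rule Lim_null_comparison)
      show "\<forall>\<^sub>F n in sequentially. norm ((\<Sum>k\<le>n. w n k * c (real k / real n)) - L (monom 1 m))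
         \<le> real m * real m / (real n - real m)"
        using eventually_gt_at_top[of "2 * m"]
      proof eventually_elim
        case (elim n)
        have nz: "real (n choose m) \<noteq> 0" using elim by simp
        have "L (monom 1 m) = (\<Sum>k\<le>n. w n k * (real (k choose m) / real (n choose m)))"
          using w_choose[of m n] elim nz by (simp add: field_simps flip: sum_divide_distrib)
        moreover have cw: "(\<Sum>k\<le>n. w n k * c (real k / real n)) = (\<Sum>k\<le>n. w n k * (real k / real n) ^ m)"
          by (intro sum.cong refl arg_cong2[of _ _ _ _ "(*)"] c frac01) simp
        ultimately have "norm ((\<Sum>k\<le>n. w n k * c (real k / real n)) - L (monom 1 m))
          = norm (\<Sum>k\<le>n. w n k * ((real k / real n) ^ m - real (k choose m) / real (n choose m)))"
          unfolding right_diff_distrib sum_subtractf cw by simp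
        also have "\<dots> \<le> (\<Sum>k\<le>n. w n k * (real m * real m / (real n - real m)))"
        proof (rule sum_norm_le)
          fix k assume "k \<in> {..n}"
          hence "\<bar>(real k / real n) ^ m - real (k choose m) / real (n choose m)\<bar> \<le> real m * real m / (real n - real m)"
            using choose_ratio_approx[of k n m] elim by (simp add: abs_minus_commute)
          thus "norm (w n k * ((real k / real n) ^ m - real (k choose m) / real (n choose m)))
            \<le> w n k * (real m * real m / (real n - real m))"
            unfolding real_norm_def abs_mult abs_of_nonneg[OF w_nonneg] by (rule mult_left_mono) (rule w_nonneg)
        qed
        also have "\<dots> = (\<Sum>k\<le>n. w n k) * (real m * real m / (real n - real m))"
          unfolding sum_distrib_right ..
        finally show ?case using w_sum by simp
      qed
      have "filterlim (\<lambda>n. real n - real m) at_top sequentially"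
        using filterlim_tendsto_add_at_top[OF tendsto_const[of "- real m"] filterlim_real_sequentially]
        by (simp add: algebra_simps)
      thus "(\<lambda>n. real m * real m / (real n - real m)) \<longlonglongrightarrow> 0"
        by (intro tendsto_divide_0[OF tendsto_const] filterlim_at_top_imp_at_infinity)
    qed
    have "(\<integral>x. c x \<partial>M) = L (monom 1 m)"
      using LIMSEQ_unique[OF 1 LIMSEQ_subseq_LIMSEQ[OF 2 r, unfolded o_def]] .
    moreover have "(\<integral>x. c x \<partial>M) = (\<integral>x. x ^ m \<partial>M)"
      by (rule integral_cong_AE) (use ae c in \<open>auto simp: c_def[abs_def]\<close>)
    ultimately show ?thesis by simp
  qed
  thus ?thesis using M ae by blast
qed

theorem hausdorff_moment:
  assumes R: "R > 0" and one: "L 1 = 1" and pos: "\<And>k l. 0 \<le> L ([:R,1:] ^ k * [:R,-1:] ^ l)"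
  shows "\<exists>M. real_distribution M \<and> (AE x in M. x \<in> {-R..R}) \<and> (\<forall>P. integrable M (poly P) \<and> (\<integral>x. poly P x \<partial>M) = L P)"
proof -
  \<comment> \<open>\<open>\<phi>\<close> maps [-R, R] affinely onto [0, 1] and
    \<open>\<psi>\<close> is its inverse; the desired law is the image under \<open>\<psi>\<close>
    of the one on [0, 1].\<close>
  define \<phi> where "\<phi> = [:1/2, 1/(2*R):]"
  define \<psi> where "\<psi> = [:-R, 2*R:]"
  have comp: "pcompose (pcompose P \<psi>) \<phi> = P" for P
    using R by (simp add: pcompose_assoc[symmetric] \<phi>_def \<psi>_def pcompose_pCons pcompose_idR)
  interpret U: poly_functional "\<lambda>P. L (pcompose P \<phi>)"
    by standard (simp_all add: pcompose_add pcompose_smult L_add L_smult)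
  have "0 \<le> L (pcompose ([:0,1:] ^ k * [:1,-1:] ^ l) \<phi>)" for k l
  proof -
    have 1: "pcompose [:0,1:] \<phi> = smult (1/(2*R)) [:R,1:]"
      using R by (simp add: \<phi>_def pcompose_pCons)
    have 2: "pcompose [:1,-1:] \<phi> = smult (1/(2*R)) [:R,-1:]"
      using R by (simp add: \<phi>_def pcompose_pCons)
    have pw: "pcompose (P ^ j) \<phi> = pcompose P \<phi> ^ j" for P j
      by (induction j) (simp_all add: pcompose_1 pcompose_mult)
    have "pcompose ([:0,1:] ^ k * [:1,-1:] ^ l) \<phi> = smult ((1/(2*R)) ^ k * (1/(2*R)) ^ l) ([:R,1:] ^ k * [:R,-1:] ^ l)"
      by (simp only: pcompose_mult pw 1 2 smult_power mult_smult_left mult_smult_right smult_smult mult.commute[of "(1 / (2*R)) ^ k"])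
    moreover have "0 \<le> (1/(2*R)) ^ k * (1/(2*R)) ^ l" using R by simp
    ultimately show ?thesis using pos[of k l] by (simp only: L_smult mult_nonneg_nonneg)
  qed
  moreover have "L (pcompose 1 \<phi>) = 1" by (simp add: pcompose_1 one)
  ultimately have "\<exists>N. real_distribution N \<and> (AE x in N. x \<in> {0..1}) \<and>
      (\<forall>m. (\<integral>x. x ^ m \<partial>N) = L (pcompose (monom 1 m) \<phi>))"
    by (intro U.hausdorff_moment_unit)
  then obtain N where N: "real_distribution N" "AE x in N. x \<in> {0..1}"
    and mom: "\<And>m. (\<integral>x. x ^ m \<partial>N) = L (pcompose (monom 1 m) \<phi>)"
    by blast
  interpret N: real_distribution N by (rule N)
  have int: "integrable N (\<lambda>x. x ^ m)" for m
  proof (rule N.integrable_const_bound[of _ 1])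
    show "AE x in N. norm (x ^ m) \<le> 1" using N(2) by eventually_elim (auto intro: power_le_one)
  qed auto
  have polyN: "integrable N (\<lambda>x. poly P x)" "(\<integral>x. poly P x \<partial>N) = L (pcompose P \<phi>)" for P
    unfolding poly_altdef U.L_altdef[of P] using int by (simp_all add: mom)
  define M where "M = distr N borel (poly \<psi>)"
  have mpoly [measurable]: "poly P \<in> borel_measurable borel" for P :: "real poly"
    by (intro borel_measurable_continuous_onI continuous_intros)
  have "prob_space M" unfolding M_def by (rule N.prob_space_distr) simp
  hence "real_distribution M" by (simp add: real_distribution_def real_distribution_axioms_def M_def)
  moreover have "AE x in M. x \<in> {-R..R}"
  proof -
    have "AE x in N. poly \<psi> x \<in> {-R..R}" using N(2)
    proof eventually_elim
      case (elim x)
      have "R * (2 * x) \<le> R * 2" using elim R by (intro mult_left_mono) auto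
      thus ?case using elim R by (auto simp: \<psi>_def algebra_simps)
    qed
    thus ?thesis unfolding M_def by (subst AE_distr_iff) auto
  qed
  moreover have "integrable M (poly P) \<and> (\<integral>x. poly P x \<partial>M) = L P" for P
    using polyN[of "pcompose P \<psi>"] comp[of P]
    by (simp add: M_def integrable_distr_eq integral_distr poly_pcompose[abs_def])
  ultimately show ?thesis by blast
qed

end

text \<open>Both characteristic functions have the same Taylor polynomials at 0, with remainder at
  most 2 |t|^n / n! times the n-th absolute moment. For even n this is an ordinary moment, so the
  bound R^n from the support of \<open>M\<close> serves \<open>N\<close> as well.\<close>

lemma real_distribution_eqI_moments:
  assumes M: "real_distribution M" and N: "real_distribution N"
    and intM: "\<And>k. integrable M (\<lambda>x. x ^ k)" and intN: "\<And>k. integrable N (\<lambda>x. x ^ k)"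
    and eq: "\<And>k. (\<integral>x. x ^ k \<partial>M) = (\<integral>x. x ^ k \<partial>N)"
    and bd: "AE x in M. \<bar>x\<bar> \<le> R"
  shows "M = N"
proof (rule Levy_uniqueness[OF M N], rule ext)
  fix t :: real
  interpret M: real_distribution M by (rule M)
  interpret N: real_distribution N by (rule N)
  define S where "S n = (\<Sum>k\<le>n. (\<i> * complex_of_real t) ^ k / fact k * complex_of_real (\<integral>x. x ^ k \<partial>M))" for n
  define e where "e n = 2 * \<bar>t\<bar> ^ (2*n) / fact (2*n) * (\<integral>x. x ^ (2*n) \<partial>M)" for n
  have M_le: "norm (char M t - S (2*n)) \<le> e n" for n
    using M.char_approx1[of "2*n" t, OF intM] unfolding S_def e_def by (simp add: power_even_abs)
  have N_le: "norm (char N t - S (2*n)) \<le> e n" for n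
    using N.char_approx1[of "2*n" t, OF intN] unfolding S_def e_def eq by (simp add: power_even_abs)
  have le: "norm (char M t - char N t) \<le> 2 * e n" for n
  proof -
    have "norm (char M t - char N t) \<le> norm (char M t - S (2*n)) + norm (char N t - S (2*n))"
      using norm_triangle_ineq4[of "char M t - S (2*n)" "char N t - S (2*n)"] by simp
    also have "\<dots> \<le> e n + e n" by (intro add_mono M_le N_le)
    finally show ?thesis by simp
  qed
  have "e \<longlonglongrightarrow> 0"
  proof (rule Lim_null_comparison)
    have "norm (e n) \<le> 2 * ((\<bar>t\<bar> * R) ^ (2*n) /\<^sub>R fact (2*n))" for n
    proof -
      have "(\<integral>x. x ^ (2*n) \<partial>M) \<le> (\<integral>x. R ^ (2*n) \<partial>M)"
      proof (rule integral_mono_AE[OF intM])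
        show "AE x in M. x ^ (2*n) \<le> R ^ (2*n)"
        proof (use bd in eventually_elim)
          fix x :: real assume "\<bar>x\<bar> \<le> R"
          hence "\<bar>x\<bar> ^ (2*n) \<le> R ^ (2*n)" by (rule power_mono) simp
          thus "x ^ (2*n) \<le> R ^ (2*n)" by (simp add: power_even_abs)
        qed
      qed simp
      hence "(\<integral>x. x ^ (2*n) \<partial>M) \<le> R ^ (2*n)" using M.prob_space by simp
      moreover have "0 \<le> (\<integral>x. x ^ (2*n) \<partial>M)" by (rule integral_nonneg_AE) simp
      ultimately show ?thesis
        using mult_left_mono[of "(\<integral>x. x ^ (2*n) \<partial>M)" "R ^ (2*n)" "2 * \<bar>t\<bar> ^ (2*n) / fact (2*n)"]
        unfolding e_def power_mult_distrib real_norm_def by (subst abs_of_nonneg) (auto simp: field_simps)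
    qed
    thus "\<forall>\<^sub>F n in sequentially. norm (e n) \<le> 2 * ((\<bar>t\<bar> * R) ^ (2*n) /\<^sub>R fact (2*n))" by simp
    have "(\<lambda>n. (\<bar>t\<bar> * R) ^ n /\<^sub>R fact n) \<longlonglongrightarrow> 0"
      by (rule summable_LIMSEQ_zero[OF summable_exp_generic])
    hence "(\<lambda>n. (\<bar>t\<bar> * R) ^ (2*n) /\<^sub>R fact (2*n)) \<longlonglongrightarrow> 0"
      using LIMSEQ_subseq_LIMSEQ[of _ 0 "\<lambda>n. 2*n"] by (auto simp: o_def strict_mono_def)
    from tendsto_mult_right_zero[OF this, of 2]
    show "(\<lambda>n. 2 * ((\<bar>t\<bar> * R) ^ (2*n) /\<^sub>R fact (2*n))) \<longlonglongrightarrow> 0" .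
  qed
  hence "(\<lambda>n. 2 * e n) \<longlonglongrightarrow> 0" by (rule tendsto_mult_right_zero)
  hence "norm (char M t - char N t) \<le> 0"
    by (rule tendsto_lowerbound) (use le in auto)
  thus "char M t = char N t" by simp
qed

section \<open>The spectral measure of a regular graph\<close>

locale rooted_regular_graph = bidirected_digraph G arev
  for G :: "('v, 'e) pre_digraph" and arev :: "'e \<Rightarrow> 'e" +
  fixes q :: nat and v :: 'v
  assumes q_pos: "q \<ge> 1"
    and degree: "a \<in> verts G \<Longrightarrow> card (out_arcs G a) = q + 1"
    and root: "v \<in> verts G"
begin

text \<open>Summation over arcs instead of neighbours takes care of multiple edges and loops. Real
  values suffice for the positivity arguments; \<open>scaled_adj_op_of_real\<close> links this to
  the complex operator.\<close>

definition adj :: "('v \<Rightarrow> real) \<Rightarrow> 'v \<Rightarrow> real" where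
  "adj f a = (if a \<in> verts G then \<Sum>e\<in>out_arcs G a. f (head G e) else 0)"

definition T :: "('v \<Rightarrow> real) \<Rightarrow> 'v \<Rightarrow> real" where
  "T f a = adj f a / sqrt (real q)"

definition fin_supp :: "('v \<Rightarrow> real) \<Rightarrow> bool" where
  "fin_supp f \<longleftrightarrow> finite {a. f a \<noteq> 0} \<and> {a. f a \<noteq> 0} \<subseteq> verts G"

text \<open>The range is finite as soon as the first argument has finite support;
  \<open>ip_eq\<close> enlarges it when several such sums are compared.\<close>

definition ip :: "('v \<Rightarrow> real) \<Rightarrow> ('v \<Rightarrow> real) \<Rightarrow> real" where
  "ip f g = (\<Sum>a | f a \<noteq> 0. f a * g a)"

text \<open>This set is closed under \<open>arev\<close>, which lets tail and head be exchanged in a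
  sum; the set of arcs leaving S is not.\<close>

definition arcs_in :: "'v set \<Rightarrow> 'e set" where
  "arcs_in S = {e \<in> arcs G. tail G e \<in> S \<and> head G e \<in> S}"

lemma sqrt_q_pos: "sqrt (real q) > 0" using q_pos by simp

lemma finite_out_arcs: "finite (out_arcs G a)"
proof (cases "a \<in> verts G")
  case True
  show ?thesis by (rule card_ge_0_finite) (simp add: degree[OF True])
next
  case False
  hence "out_arcs G a = {}" by (auto simp: out_arcs_def)
  thus ?thesis by simp
qed

lemma finite_arcs_from:
  assumes "finite S" shows "finite {e \<in> arcs G. tail G e \<in> S}"
proof -
  have "{e \<in> arcs G. tail G e \<in> S} \<subseteq> (\<Union>a\<in>S. out_arcs G a)" by auto
  thus ?thesis using assms finite_out_arcs by (meson finite_UN_I finite_subset)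
qed

lemma ip_eq: "finite S \<Longrightarrow> {a. f a \<noteq> 0} \<subseteq> S \<Longrightarrow> ip f g = (\<Sum>a\<in>S. f a * g a)"
  unfolding ip_def by (rule sum.mono_neutral_left) auto

lemma sum_adj:
  assumes S: "finite S" "S \<subseteq> verts G" and g: "{a. g a \<noteq> 0} \<subseteq> S"
  shows "(\<Sum>a\<in>S. f a * adj g a) = (\<Sum>e\<in>arcs_in S. f (tail G e) * g (head G e))"
proof -
  let ?E = "{e \<in> arcs G. tail G e \<in> S}"
  have "(\<Sum>a\<in>S. f a * adj g a) = (\<Sum>a\<in>S. \<Sum>e\<in>{e \<in> ?E. tail G e = a}. f (tail G e) * g (head G e))"
  proof (rule sum.cong[OF refl])
    fix a assume a: "a \<in> S"
    hence "{e \<in> ?E. tail G e = a} = out_arcs G a" by auto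
    thus "f a * adj g a = (\<Sum>e\<in>{e \<in> ?E. tail G e = a}. f (tail G e) * g (head G e))"
      using a S by (auto simp: adj_def sum_distrib_left intro!: sum.cong)
  qed
  also have "\<dots> = (\<Sum>e\<in>?E. f (tail G e) * g (head G e))"
    by (rule sum.group) (use S finite_arcs_from in auto)
  \<comment> \<open>Arcs that leave S drop out because g vanishes at their heads.\<close>
  also have "\<dots> = (\<Sum>e\<in>arcs_in S. f (tail G e) * g (head G e))"
    by (rule sum.mono_neutral_right) (use S g finite_arcs_from in \<open>auto simp: arcs_in_def\<close>)
  finally show ?thesis .
qed

lemma sum_arcs_in_arev:
  "(\<Sum>e\<in>arcs_in S. F (tail G e) (head G e)) = (\<Sum>e\<in>arcs_in S. F (head G e) (tail G e))"
  by (rule sum.reindex_bij_witness[of _ arev arev]) (auto simp: arcs_in_def)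

lemma fin_supp_adj:
  assumes "fin_supp f" shows "fin_supp (adj f)"
proof -
  have "{a. adj f a \<noteq> 0} \<subseteq> (\<Union>b\<in>{b. f b \<noteq> 0}. head G ` out_arcs G b)"
  proof
    fix a assume "a \<in> {a. adj f a \<noteq> 0}"
    hence "a \<in> verts G" "(\<Sum>e\<in>out_arcs G a. f (head G e)) \<noteq> 0"
      by (auto simp: adj_def split: if_splits)
    then obtain e where e: "e \<in> out_arcs G a" "f (head G e) \<noteq> 0"
      by (meson sum.neutral)
    hence "arev e \<in> out_arcs G (head G e)" "head G (arev e) = a" by auto
    thus "a \<in> (\<Union>b\<in>{b. f b \<noteq> 0}. head G ` out_arcs G b)" using e by blast
  qed
  moreover have "finite (\<Union>b\<in>{b. f b \<noteq> 0}. head G ` out_arcs G b)"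
    using assms finite_out_arcs by (auto simp: fin_supp_def)
  ultimately have "finite {a. adj f a \<noteq> 0}" by (rule finite_subset)
  thus ?thesis by (auto simp: fin_supp_def adj_def)
qed

lemma fin_supp_T: "fin_supp f \<Longrightarrow> fin_supp (T f)"
  using fin_supp_adj[of f] sqrt_q_pos by (simp add: fin_supp_def T_def)

lemma ip_T_symmetric:
  assumes f: "fin_supp f" and g: "fin_supp g"
  shows "ip (T f) g = ip f (T g)"
proof -
  \<comment> \<open>The support of \<open>T f\<close> is included because the left-hand inner
    product sums over it.\<close>
  define S where "S = {a. f a \<noteq> 0} \<union> {a. g a \<noteq> 0} \<union> {a. T f a \<noteq> 0}"
  have S: "finite S" "S \<subseteq> verts G"
    using f g fin_supp_T[OF f] by (auto simp: S_def fin_supp_def)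
  have "ip (T f) g = (\<Sum>a\<in>S. g a * adj f a) / sqrt (real q)"
    by (subst ip_eq[OF S(1)]) (auto simp: S_def T_def sum_divide_distrib mult_ac)
  also have "(\<Sum>a\<in>S. g a * adj f a) = (\<Sum>e\<in>arcs_in S. g (tail G e) * f (head G e))"
    by (rule sum_adj[OF S]) (auto simp: S_def)
  also have "\<dots> = (\<Sum>e\<in>arcs_in S. f (tail G e) * g (head G e))"
    using sum_arcs_in_arev[of "\<lambda>x y. g x * f y" S] by (simp add: mult_ac)
  also have "\<dots> = (\<Sum>a\<in>S. f a * adj g a)"
    by (rule sum_adj[OF S, symmetric]) (auto simp: S_def)
  also have "\<dots> / sqrt (real q) = ip f (T g)"
    by (subst ip_eq[OF S(1)]) (auto simp: S_def T_def sum_divide_distrib)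
  finally show ?thesis .
qed

text \<open>Degree over sqrt q, the bound for the form of \<open>T\<close>. It equals sqrt q +
  1/sqrt q, the value of z + 1/z at z = sqrt q; this is how the radius 1/sqrt q enters
  later.\<close>

definition R :: real where "R = (real q + 1) / sqrt (real q)"

text \<open>Apply 2|xy| \<le> x^2 + y^2 on each arc. By reversal of arcs the two squares have equal
  sums, and each vertex is the tail of q + 1 arcs.\<close>

lemma abs_ip_T_le:
  assumes f: "fin_supp f"
  shows "\<bar>ip f (T f)\<bar> \<le> R * ip f f"
proof -
  define S where "S = {a. f a \<noteq> 0}"
  have S: "finite S" "S \<subseteq> verts G" using f by (auto simp: S_def fin_supp_def)
  have "\<bar>\<Sum>e\<in>arcs_in S. f (tail G e) * f (head G e)\<bar>
      \<le> (\<Sum>e\<in>arcs_in S. ((f (tail G e))\<^sup>2 + (f (head G e))\<^sup>2) / 2)"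
  proof (rule sum_abs[THEN order_trans], rule sum_mono)
    fix e
    have "0 \<le> (\<bar>f (tail G e)\<bar> - \<bar>f (head G e)\<bar>)\<^sup>2" by simp
    thus "\<bar>f (tail G e) * f (head G e)\<bar> \<le> ((f (tail G e))\<^sup>2 + (f (head G e))\<^sup>2) / 2"
      unfolding power2_diff abs_mult by simp
  qed
  also have "\<dots> = ((\<Sum>e\<in>arcs_in S. (f (tail G e))\<^sup>2) + (\<Sum>e\<in>arcs_in S. (f (head G e))\<^sup>2)) / 2"
    by (simp add: sum.distrib flip: sum_divide_distrib)
  also have "\<dots> = (\<Sum>e\<in>arcs_in S. (f (tail G e))\<^sup>2)"
    using sum_arcs_in_arev[of "\<lambda>x y. (f x)\<^sup>2" S] by simp
  also have "\<dots> \<le> (\<Sum>e\<in>{e \<in> arcs G. tail G e \<in> S}. (f (tail G e))\<^sup>2)"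
    by (rule sum_mono2) (use finite_arcs_from S in \<open>auto simp: arcs_in_def\<close>)
  also have "\<dots> = (\<Sum>a\<in>S. \<Sum>e\<in>{e \<in> {e \<in> arcs G. tail G e \<in> S}. tail G e = a}. (f (tail G e))\<^sup>2)"
    by (rule sum.group[symmetric]) (use S finite_arcs_from in auto)
  also have "\<dots> = (\<Sum>a\<in>S. (real q + 1) * (f a)\<^sup>2)"
  proof (rule sum.cong[OF refl])
    fix a assume a: "a \<in> S"
    hence "{e \<in> {e \<in> arcs G. tail G e \<in> S}. tail G e = a} = out_arcs G a" by auto
    hence "(\<Sum>e\<in>{e \<in> {e \<in> arcs G. tail G e \<in> S}. tail G e = a}. (f (tail G e))\<^sup>2)
        = (\<Sum>e\<in>out_arcs G a. (f a)\<^sup>2)" by simp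
    thus "(\<Sum>e\<in>{e \<in> {e \<in> arcs G. tail G e \<in> S}. tail G e = a}. (f (tail G e))\<^sup>2)
        = (real q + 1) * (f a)\<^sup>2" using a S degree[of a] by auto
  qed
  finally have "\<bar>\<Sum>e\<in>arcs_in S. f (tail G e) * f (head G e)\<bar> \<le> (real q + 1) * ip f f"
    by (simp add: ip_def S_def sum_distrib_left power2_eq_square)
  moreover have "ip f (T f) = (\<Sum>e\<in>arcs_in S. f (tail G e) * f (head G e)) / sqrt (real q)"
    unfolding sum_adj[OF S, of f f, unfolded S_def, OF order_refl, folded S_def, symmetric]
    by (simp add: ip_def T_def S_def sum_divide_distrib)
  ultimately show ?thesis using sqrt_q_pos by (simp add: R_def field_simps)
qed

lemma ip_self_nonneg: "ip f f \<ge> 0"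
  unfolding ip_def by (rule sum_nonneg) simp

section \<open>Polynomials in the operator, and positivity of the moment functional\<close>

definition \<delta> :: "'v \<Rightarrow> real" where "\<delta> = indicator {v}"

definition poly_T :: "real poly \<Rightarrow> 'v \<Rightarrow> real" where
  "poly_T P a = (\<Sum>i\<le>degree P. coeff P i * (T ^^ i) \<delta> a)"

definition L :: "real poly \<Rightarrow> real" where "L P = poly_T P v"

lemma poly_T_eq: "degree P \<le> N \<Longrightarrow> poly_T P a = (\<Sum>i\<le>N. coeff P i * (T ^^ i) \<delta> a)"
  unfolding poly_T_def by (rule sum.mono_neutral_left) (auto simp: coeff_eq_0)

lemma poly_T_0 [simp]: "poly_T 0 = (\<lambda>_. 0)"
  by (simp add: poly_T_def fun_eq_iff)

lemma poly_T_add: "poly_T (P + Q) a = poly_T P a + poly_T Q a"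
proof -
  define N where "N = max (degree P) (degree Q)"
  have "degree (P + Q) \<le> N" "degree P \<le> N" "degree Q \<le> N"
    by (auto simp: N_def degree_add_le_max)
  thus ?thesis by (simp add: poly_T_eq sum.distrib algebra_simps)
qed

lemma poly_T_smult: "poly_T (smult c P) a = c * poly_T P a"
  by (simp add: poly_T_eq[of "smult c P" "degree P"] poly_T_def sum_distrib_left mult_ac)

lemma poly_T_diff: "poly_T (P - Q) a = poly_T P a - poly_T Q a"
  using poly_T_add[of P "smult (-1) Q" a] poly_T_smult[of "-1" Q a] by simp

lemma T_sum: "T (\<lambda>a. \<Sum>i\<in>I. c i * F i a) a = (\<Sum>i\<in>I. c i * T (F i) a)"
  by (auto simp: T_def adj_def sum_divide_distrib sum_distrib_left intro: sum.swap)

lemma T_smult: "T (\<lambda>a. c * f a) a = c * T f a"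
  by (simp add: T_def adj_def sum_distrib_left)

lemma poly_T_pCons: "poly_T (pCons c P) a = c * \<delta> a + T (poly_T P) a"
proof -
  have "poly_T (pCons c P) a = (\<Sum>i\<le>Suc (degree P). coeff (pCons c P) i * (T ^^ i) \<delta> a)"
    by (rule poly_T_eq) (simp add: degree_pCons_le)
  also have "\<dots> = c * \<delta> a + (\<Sum>i\<le>degree P. coeff P i * T ((T ^^ i) \<delta>) a)"
    by (simp add: sum.atMost_Suc_shift del: sum.atMost_Suc)
  also have "(\<Sum>i\<le>degree P. coeff P i * T ((T ^^ i) \<delta>) a) = T (poly_T P) a"
    unfolding poly_T_def[abs_def] by (rule T_sum[symmetric])
  finally show ?thesis .
qed

lemma fin_supp_add:
  assumes "fin_supp f" "fin_supp g" shows "fin_supp (\<lambda>a. c * f a + g a)"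
proof -
  have "{a. c * f a + g a \<noteq> 0} \<subseteq> {a. f a \<noteq> 0} \<union> {a. g a \<noteq> 0}" by auto
  thus ?thesis using assms unfolding fin_supp_def by (meson Un_subset_iff finite_Un finite_subset order_trans)
qed

lemma fin_supp_\<delta>: "fin_supp \<delta>"
  using root by (auto simp: fin_supp_def \<delta>_def indicator_def)

lemma fin_supp_poly_T: "fin_supp (poly_T P)"
proof (induction P)
  case 0 thus ?case by (simp add: fin_supp_def)
next
  case (pCons c P)
  have "poly_T (pCons c P) = (\<lambda>a. c * \<delta> a + T (poly_T P) a)"
    by (simp add: poly_T_pCons fun_eq_iff)
  thus ?case using fin_supp_add[OF fin_supp_\<delta> fin_supp_T[OF pCons.IH]] by simp
qed

lemma ip_add_left:
  assumes "fin_supp f" "fin_supp g"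
  shows "ip (\<lambda>a. c * f a + g a) h = c * ip f h + ip g h"
proof -
  define S where "S = {a. f a \<noteq> 0} \<union> {a. g a \<noteq> 0}"
  have S: "finite S" using assms by (auto simp: S_def fin_supp_def)
  have "ip (\<lambda>a. c * f a + g a) h = (\<Sum>a\<in>S. (c * f a + g a) * h a)"
    by (rule ip_eq[OF S]) (auto simp: S_def)
  also have "\<dots> = c * (\<Sum>a\<in>S. f a * h a) + (\<Sum>a\<in>S. g a * h a)"
    by (simp add: sum.distrib sum_distrib_left algebra_simps)
  also have "(\<Sum>a\<in>S. f a * h a) = ip f h" by (rule ip_eq[OF S, symmetric]) (auto simp: S_def)
  also have "(\<Sum>a\<in>S. g a * h a) = ip g h" by (rule ip_eq[OF S, symmetric]) (auto simp: S_def)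
  finally show ?thesis .
qed

lemma ip_\<delta>: "ip \<delta> h = h v"
  by (subst ip_eq[of "{v}"]) (auto simp: \<delta>_def indicator_def)

sublocale L: poly_functional L
  by standard (simp_all add: L_def poly_T_add poly_T_smult)

text \<open>Symmetry of \<open>T\<close> moves the factors of P(T) to the other argument one at a
  time; each step replaces Q by x Q, so the induction keeps Q arbitrary.\<close>

lemma L_mult_eq_ip: "L (P * Q) = ip (poly_T P) (poly_T Q)"
proof (induction P arbitrary: Q)
  case 0 show ?case by (simp add: L.L_0 ip_def)
next
  case (pCons c P)
  have "poly_T (pCons c P) = (\<lambda>a. c * \<delta> a + T (poly_T P) a)"
    by (simp add: poly_T_pCons fun_eq_iff)
  hence "ip (poly_T (pCons c P)) (poly_T Q) = c * poly_T Q v + ip (T (poly_T P)) (poly_T Q)"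
    by (simp add: ip_add_left fin_supp_\<delta> fin_supp_T fin_supp_poly_T ip_\<delta>)
  also have "ip (T (poly_T P)) (poly_T Q) = ip (poly_T P) (T (poly_T Q))"
    by (intro ip_T_symmetric fin_supp_poly_T)
  also have "T (poly_T Q) = poly_T (pCons 0 Q)" by (simp add: poly_T_pCons fun_eq_iff)
  also have "ip (poly_T P) (poly_T (pCons 0 Q)) = L (P * pCons 0 Q)" by (rule pCons.IH[symmetric])
  also have "c * poly_T Q v + L (P * pCons 0 Q) = L (pCons c P * Q)"
    by (simp add: L.L_add L.L_smult flip: L_def)
  finally show ?case ..
qed

lemma L_square_nonneg: "0 \<le> L (P * P)"
  by (simp add: L_mult_eq_ip ip_self_nonneg)

lemma R_pos: "R > 0" using sqrt_q_pos q_pos by (simp add: R_def)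

text \<open>By \<open>abs_ip_T_le\<close> the quadratic forms of R + T and R - T are nonnegative;
  here they are evaluated at P(T) \<open>\<delta>\<close>.\<close>

lemma L_linear_times_square_nonneg:
  assumes "\<bar>s\<bar> = 1"
  shows "0 \<le> L ([:R, s:] * (P * P))"
proof -
  have "[:R, s:] * (P * P) = smult R (P * P) + smult s (P * pCons 0 P)" by simp
  also have "L \<dots> = R * ip (poly_T P) (poly_T P) + s * ip (poly_T P) (poly_T (pCons 0 P))"
    by (simp only: L.L_add L.L_smult L_mult_eq_ip)
  also have "poly_T (pCons 0 P) = T (poly_T P)" by (simp add: poly_T_pCons fun_eq_iff)
  finally have eq: "L ([:R, s:] * (P * P))
    = R * ip (poly_T P) (poly_T P) + s * ip (poly_T P) (T (poly_T P))" .
  have "s = 1 \<or> s = -1" using assms by auto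
  thus ?thesis using abs_ip_T_le[OF fin_supp_poly_T[of P]] unfolding eq by auto
qed

text \<open>The product of two nonnegative operators is handled through
  \<open>2R(R\<^sup>2 - x\<^sup>2) = (R - x)(R + x)\<^sup>2 + (R + x)(R - x)\<^sup>2\<close>.\<close>

lemma L_product_times_square_nonneg: "0 \<le> L ([:R, 1:] * [:R, -1:] * (P * P))"
proof -
  have two_R: "[:2 * R:] = [:R, 1:] + [:R, -1:]" by simp
  have "smult (2 * R) ([:R, 1:] * [:R, -1:] * (P * P)) = [:2 * R:] * ([:R, 1:] * [:R, -1:] * (P * P))"
    by simp
  also have "\<dots> = [:R, -1:] * (([:R, 1:] * P) * ([:R, 1:] * P)) + [:R, 1:] * (([:R, -1:] * P) * ([:R, -1:] * P))"
    unfolding two_R by (simp only: algebra_simps)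
  finally have "2 * R * L ([:R, 1:] * [:R, -1:] * (P * P))
      = L ([:R, -1:] * (([:R, 1:] * P) * ([:R, 1:] * P))) + L ([:R, 1:] * (([:R, -1:] * P) * ([:R, -1:] * P)))"
    by (metis L.L_add L.L_smult)
  moreover have "0 \<le> L ([:R, -1:] * (([:R, 1:] * P) * ([:R, 1:] * P)))"
    "0 \<le> L ([:R, 1:] * (([:R, -1:] * P) * ([:R, -1:] * P)))"
    by (rule L_linear_times_square_nonneg; simp)+
  ultimately have "0 \<le> 2 * R * L ([:R, 1:] * [:R, -1:] * (P * P))" by linarith
  thus ?thesis using R_pos by (simp add: zero_le_mult_iff)
qed

text \<open>Pairing equal factors leaves a square \<open>P * P\<close> and at most one factor of
  each kind, so the parities of k and l decide between the preceding lemmas.\<close>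

lemma L_bernstein_nonneg: "0 \<le> L ([:R, 1:] ^ k * [:R, -1:] ^ l)"
proof -
  define P where "P = [:R, 1:] ^ (k div 2) * [:R, -1:] ^ (l div 2)"
  have k: "[:R, 1:] ^ k = [:R, 1:] ^ (k mod 2) * ([:R, 1:] ^ (k div 2) * [:R, 1:] ^ (k div 2))"
    by (simp only: flip: power_add) (metis mod_mult_div_eq mult_2)
  have l: "[:R, -1:] ^ l = [:R, -1:] ^ (l mod 2) * ([:R, -1:] ^ (l div 2) * [:R, -1:] ^ (l div 2))"
    by (simp only: flip: power_add) (metis mod_mult_div_eq mult_2)
  have eq: "[:R, 1:] ^ k * [:R, -1:] ^ l = [:R, 1:] ^ (k mod 2) * [:R, -1:] ^ (l mod 2) * (P * P)"
    unfolding P_def by (subst k, subst l) (simp only: mult_ac)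
  consider "k mod 2 = 0" "l mod 2 = 0" | "k mod 2 = 1" "l mod 2 = 0" | "k mod 2 = 0" "l mod 2 = 1"
    | "k mod 2 = 1" "l mod 2 = 1" by linarith
  thus ?thesis unfolding eq
    by cases (simp_all only: power_0 power_one_right mult_1 mult_1_right L_square_nonneg
        L_linear_times_square_nonneg L_product_times_square_nonneg abs_1 abs_minus)
qed

lemma L_1: "L 1 = 1"
  using L_mult_eq_ip[of 1 1] by (simp add: L_def poly_T_def \<delta>_def)

lemma L_monom: "L (monom 1 i) = (T ^^ i) \<delta> v"
proof -
  have "poly_T (monom 1 i) v = (\<Sum>j\<le>i. coeff (monom 1 i) j * (T ^^ j) \<delta> v)"
    by (rule poly_T_eq) (simp add: degree_monom_le)
  also have "\<dots> = (\<Sum>j\<in>{i}. coeff (monom 1 i) j * (T ^^ j) \<delta> v)"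
    by (rule sum.mono_neutral_right) auto
  finally show ?thesis by (simp add: L_def)
qed

section \<open>Comparison with the complex operators, and identification of the spectral
  measure\<close>

lemma adj_op_eq:
  assumes "a \<in> verts G"
  shows "adj_op G f a = (\<Sum>e\<in>out_arcs G a. f (head G e))"
proof -
  define S where "S = head G ` out_arcs G a"
  have S: "finite S" "S \<subseteq> verts G" using finite_out_arcs by (auto simp: S_def)
  have z: "adj_entry G a b = 0" if "b \<notin> S" for b
  proof -
    have "{e \<in> arcs G. tail G e = a \<and> head G e = b} = {}" using that by (auto simp: S_def)
    thus ?thesis unfolding adj_entry_def by (simp only: card.empty)
  qed
  have "adj_op G f a = (\<Sum>\<^sub>\<infinity>b\<in>S. of_nat (adj_entry G a b) * f b)"
    unfolding adj_op_def if_P[OF assms] by (rule infsum_cong_neutral) (use S z in auto)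
  also have "\<dots> = (\<Sum>b\<in>S. of_nat (adj_entry G a b) * f b)" using S by simp
  also have "\<dots> = (\<Sum>b\<in>S. \<Sum>e\<in>{e \<in> out_arcs G a. head G e = b}. f (head G e))"
    by (rule sum.cong) (auto simp: adj_entry_def out_arcs_def conj_ac)
  also have "\<dots> = (\<Sum>e\<in>out_arcs G a. f (head G e))"
    by (rule sum.group) (use S finite_out_arcs in \<open>auto simp: S_def\<close>)
  finally show ?thesis .
qed

lemma scaled_adj_op_of_real: "scaled_adj_op q G (\<lambda>a. of_real (f a)) = (\<lambda>a. of_real (T f a))"
proof
  fix a
  show "scaled_adj_op q G (\<lambda>a. of_real (f a)) a = of_real (T f a)"
    by (cases "a \<in> verts G")
       (simp_all add: scaled_adj_op_def adj_op_eq T_def adj_def, simp add: adj_op_def)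
qed

lemma scaled_adj_op_funpow: "(scaled_adj_op q G ^^ i) (indicator {v}) = (\<lambda>a. of_real ((T ^^ i) \<delta> a))"
proof (induction i)
  case 0 show ?case by (auto simp: \<delta>_def indicator_def)
qed (simp add: scaled_adj_op_of_real)

text \<open>The definition tests complex polynomials, the moment problem real ones. As all moments
  are real, both amount to integrability and prescribed integrals of the monomials.\<close>

lemma is_spectral_measure_iff:
  "is_spectral_measure q G v M \<longleftrightarrow>
     real_distribution M \<and> (\<forall>P. integrable M (\<lambda>x. poly P x) \<and> (\<integral>x. poly P x \<partial>M) = L P)"
proof -
  have ell: "ell2_inner (verts G) (indicator {v}) g = g v" for g
  proof -
    have "ell2_inner (verts G) (indicator {v}) g = (\<Sum>\<^sub>\<infinity>x\<in>{v}. cnj (indicator {v} x) * g x)"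
      unfolding ell2_inner_def using root by (intro infsum_cong_neutral) auto
    thus ?thesis by simp
  qed
  have mom: "ell2_inner (verts G) (indicator {v}) (op_poly P (scaled_adj_op q G) (indicator {v}))
      = (\<Sum>i\<le>degree P. coeff P i * of_real (L (monom 1 i)))" for P
    by (simp add: ell op_poly_def scaled_adj_op_funpow L_monom)
  show ?thesis
  proof
    assume M: "is_spectral_measure q G v M"
    have "integrable M (\<lambda>x. poly P x) \<and> (\<integral>x. poly P x \<partial>M) = L P" for P
    proof -
      define P' where "P' = map_poly complex_of_real P"
      have P': "poly P' (of_real x) = of_real (poly P x)" for x
        unfolding P'_def by (induction P) (simp_all add: map_poly_pCons)
      have "integrable M (\<lambda>x. complex_of_real (poly P x))"
        "(\<integral>x. complex_of_real (poly P x) \<partial>M) = (\<Sum>i\<le>degree P. of_real (coeff P i * L (monom 1 i)))"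
        using M unfolding is_spectral_measure_def mom P'[symmetric]
        by (auto simp: P'_def coeff_map_poly degree_map_poly)
      thus ?thesis unfolding complex_of_real_integrable_eq integral_complex_of_real of_real_sum[symmetric]
          of_real_eq_iff by (simp add: L.L_altdef[of P])
    qed
    thus "real_distribution M \<and> (\<forall>P. integrable M (\<lambda>x. poly P x) \<and> (\<integral>x. poly P x \<partial>M) = L P)"
      using M by (auto simp: is_spectral_measure_def real_distribution_def real_distribution_axioms_def)
  next
    assume *: "real_distribution M \<and> (\<forall>P. integrable M (\<lambda>x. poly P x) \<and> (\<integral>x. poly P x \<partial>M) = L P)"
    have "poly (monom 1 i) = (\<lambda>x::real. x ^ i)" for i by (simp add: poly_monom fun_eq_iff)
    hence m: "integrable M (\<lambda>x. complex_of_real x ^ i)"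
      "(\<integral>x. complex_of_real x ^ i \<partial>M) = of_real (L (monom 1 i))" for i
      using *[THEN conjunct2, rule_format, of "monom 1 i"]
      by (simp_all add: complex_of_real_integrable_eq integral_complex_of_real flip: of_real_power)
    show "is_spectral_measure q G v M"
      unfolding is_spectral_measure_def mom poly_altdef
      using * m by (auto simp: real_distribution_def real_distribution_axioms_def)
  qed
qed

text \<open>For a definite description existence alone says nothing; the law from the moment problem
  has bounded support, and this supplies the uniqueness.\<close>

theorem spectral_measure_props:
  defines "M \<equiv> spectral_measure q G v"
  shows "real_distribution M" "AE x in M. \<bar>x\<bar> \<le> R"
    "integrable M (\<lambda>x. poly P x)" "(\<integral>x. poly P x \<partial>M) = L P"
proof -
  obtain N where N: "real_distribution N" "AE x in N. x \<in> {-R..R}"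
    "\<And>P. integrable N (\<lambda>x. poly P x)" "\<And>P. (\<integral>x. poly P x \<partial>N) = L P"
    using L.hausdorff_moment[OF R_pos L_1 L_bernstein_nonneg] by blast
  have bd: "AE x in N. \<bar>x\<bar> \<le> R" using N(2) by eventually_elim auto
  have "M = N" unfolding M_def spectral_measure_def
  proof (rule the_equality)
    show "is_spectral_measure q G v N" using N by (simp add: is_spectral_measure_iff)
    fix N' assume "is_spectral_measure q G v N'"
    hence N': "real_distribution N'" "\<And>P. integrable N' (\<lambda>x. poly P x)" "\<And>P. (\<integral>x. poly P x \<partial>N') = L P"
      by (simp_all add: is_spectral_measure_iff)
    have "integrable N (\<lambda>x. x ^ k)" "integrable N' (\<lambda>x. x ^ k)" "(\<integral>x. x ^ k \<partial>N) = (\<integral>x. x ^ k \<partial>N')" for k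
      using N(3,4)[of "monom 1 k"] N'(2,3)[of "monom 1 k"] by (simp_all add: poly_monom)
    hence "N = N'" by (intro real_distribution_eqI_moments[OF N(1) N'(1) _ _ _ bd])
    thus "N' = N" ..
  qed
  thus "real_distribution M" "AE x in M. \<bar>x\<bar> \<le> R"
    "integrable M (\<lambda>x. poly P x)" "(\<integral>x. poly P x \<partial>M) = L P"
    using N bd by auto
qed

end

section \<open>Non-backtracking walks\<close>

text \<open>The recursion obtained by clearing the denominator 1 - x t + t^2. The numerator term
  -t^2/q changes it only in degree 2, whence the exceptional factor 1 + 1/q.\<close>

fun X_poly :: "nat \<Rightarrow> nat \<Rightarrow> real poly" where
  "X_poly q 0 = 1"
| "X_poly q (Suc 0) = [:0, 1:]"
| "X_poly q (Suc (Suc r)) =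
     [:0, 1:] * X_poly q (Suc r) - smult (if r = 0 then 1 + 1 / real q else 1) (X_poly q r)"

lemma X_fun_eq_poly: "X_fun r q x = poly (X_poly q r) x"
proof -
  define D :: "real fps" where "D = 1 - fps_const x * fps_X + fps_X ^ 2"
  define N :: "real fps" where "N = 1 - fps_const (1 / real q) * fps_X ^ 2"
  define F where "F = N / D"
  have D0: "fps_nth D 0 = 1" by (simp add: D_def)
  hence "F * D = N"
    by (simp add: F_def fps_divide_unit mult.assoc inverse_mult_eq_1)
  hence "F - fps_const x * (F * fps_X) + F * fps_X ^ 2 = N" by (simp add: D_def algebra_simps)
  hence *: "fps_nth (F - fps_const x * (F * fps_X) + F * fps_X ^ 2) n = fps_nth N n" for n by simp
  have rec: "fps_nth F (Suc (Suc n)) = x * fps_nth F (Suc n) - (if n = 0 then 1 + 1 / real q else 1) * fps_nth F n" for n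
    using *[of "Suc (Suc n)"] *[of 0] by (auto simp: N_def fps_X_power_mult_right_nth fps_X_power_nth)
  have "fps_nth F r = poly (X_poly q r) x"
  proof (induction r rule: induct_nat_012)
    case 0 show ?case using *[of 0] by (simp add: N_def)
  next
    case 1 show ?case using *[of "Suc 0"] *[of 0] by (simp add: N_def fps_X_power_mult_right_nth)
  next
    case (ge2 r) thus ?case by (simp add: rec)
  qed
  thus ?thesis by (simp add: X_fun_def F_def N_def D_def)
qed

context rooted_regular_graph
begin

text \<open>The end \<open>v\<close> is fixed and the start is free, so that splitting off the first
  arc becomes an application of \<open>adj\<close>.\<close>

definition nb_walks :: "nat \<Rightarrow> 'v \<Rightarrow> 'e list set" where
  "nb_walks r a = {p. awalk a p v \<and> length p = r \<and> non_backtracking arev p}"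

definition nb_count :: "nat \<Rightarrow> 'v \<Rightarrow> real" where
  "nb_count r a = real (card (nb_walks r a))"

lemma non_backtracking_Cons:
  "non_backtracking arev (e # p) \<longleftrightarrow> (p = [] \<or> hd p \<noteq> arev e) \<and> non_backtracking arev p"
  (is "?l \<longleftrightarrow> ?r")
proof
  assume l: ?l
  have "hd p \<noteq> arev e" if "p \<noteq> []"
    using l that by (auto simp: non_backtracking_def hd_conv_nth dest: spec[of _ 0])
  moreover have "non_backtracking arev p"
    unfolding non_backtracking_def
  proof (intro allI impI)
    fix i assume "Suc i < length p"
    thus "p ! Suc i \<noteq> arev (p ! i)" using l by (auto simp: non_backtracking_def dest: spec[of _ "Suc i"])
  qed
  ultimately show ?r by blast
next
  assume r: ?r
  show ?l unfolding non_backtracking_def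
  proof (intro allI impI)
    fix i assume i: "Suc i < length (e # p)"
    show "(e # p) ! Suc i \<noteq> arev ((e # p) ! i)"
      using r i by (cases i) (auto simp: non_backtracking_def hd_conv_nth)
  qed
qed

lemma Cons_in_nb_walks:
  "e # p \<in> nb_walks (Suc r) a \<longleftrightarrow>
     a \<in> verts G \<and> e \<in> out_arcs G a \<and> p \<in> nb_walks r (head G e) \<and> (p = [] \<or> hd p \<noteq> arev e)"
  by (auto simp: nb_walks_def non_backtracking_Cons awalk_def)

lemma nb_walks_SucE:
  assumes "p \<in> nb_walks (Suc r) a" obtains e p' where "p = e # p'"
  using assms by (cases p) (auto simp: nb_walks_def)

lemma nb_walks_0: "nb_walks 0 a = (if a = v then {[]} else {})"
  using root by (auto simp: nb_walks_def awalk_def non_backtracking_def)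

lemma nb_walks_outside: "a \<notin> verts G \<Longrightarrow> nb_walks r a = {}"
  by (auto simp: nb_walks_def awalk_def)

lemma finite_nb_walks: "finite (nb_walks r a)"
proof (induction r arbitrary: a)
  case (Suc r)
  have "nb_walks (Suc r) a \<subseteq> (\<Union>e\<in>out_arcs G a. (#) e ` nb_walks r (head G e))"
  proof
    fix p assume p: "p \<in> nb_walks (Suc r) a"
    then obtain e p' where "p = e # p'" by (rule nb_walks_SucE)
    thus "p \<in> (\<Union>e\<in>out_arcs G a. (#) e ` nb_walks r (head G e))"
      using p Cons_in_nb_walks[of e p' r a] by blast
  qed
  thus ?case using Suc finite_out_arcs by (meson finite_UN_I finite_imageI finite_subset)
qed (simp add: nb_walks_0)

text \<open>Prepending an arc \<open>e\<close> to a non-backtracking walk \<open>p\<close> gives a non-backtracking walk,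
  unless \<open>p\<close> begins with the reverse of \<open>e\<close>; in that case removing this first arc leaves a
  walk from \<open>a\<close> that does not begin with \<open>e\<close>.\<close>

lemma card_prepend:
  assumes a: "a \<in> verts G"
  shows "(\<Sum>e\<in>out_arcs G a. card (nb_walks r (head G e))) =
    card (nb_walks (Suc r) a) +
    (case r of 0 \<Rightarrow> 0 | Suc r' \<Rightarrow> (if r' = 0 then q + 1 else q) * card (nb_walks r' a))"
proof -
  define B where "B = (SIGMA e:out_arcs G a. nb_walks r (head G e))"
  define B1 where "B1 = {x \<in> B. snd x = [] \<or> hd (snd x) \<noteq> arev (fst x)}"
  define B2 where "B2 = {x \<in> B. snd x \<noteq> [] \<and> hd (snd x) = arev (fst x)}"
  have finB: "finite B" unfolding B_def by (intro finite_SigmaI finite_out_arcs finite_nb_walks)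
  have "(\<Sum>e\<in>out_arcs G a. card (nb_walks r (head G e))) = card B"
    unfolding B_def by (rule card_SigmaI[symmetric]) (auto simp: finite_out_arcs finite_nb_walks)
  also have "\<dots> = card (B1 \<union> B2)" by (rule arg_cong[of _ _ card]) (auto simp: B1_def B2_def)
  also have "\<dots> = card B1 + card B2"
    by (rule card_Un_disjoint) (use finB in \<open>auto simp: B1_def B2_def\<close>)
  also have "card B1 = card (nb_walks (Suc r) a)"
  proof (rule bij_betw_same_card[of "\<lambda>(e, p). e # p"], rule bij_betw_imageI)
    show "inj_on (\<lambda>(e, p). e # p) B1" by (auto simp: inj_on_def)
    show "(\<lambda>(e, p). e # p) ` B1 = nb_walks (Suc r) a"
    proof safe
      fix e p assume "(e, p) \<in> B1"
      thus "e # p \<in> nb_walks (Suc r) a" using a by (simp add: B1_def B_def Cons_in_nb_walks)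
    next
      fix p assume p: "p \<in> nb_walks (Suc r) a"
      then obtain e p' where ep: "p = e # p'" by (rule nb_walks_SucE)
      hence "(e, p') \<in> B1" using p Cons_in_nb_walks[of e p' r a] by (auto simp: B1_def B_def)
      thus "p \<in> (\<lambda>(e, p). e # p) ` B1" using ep by force
    qed
  qed
  also have "card B2 = (case r of 0 \<Rightarrow> 0 | Suc r' \<Rightarrow> (if r' = 0 then q + 1 else q) * card (nb_walks r' a))"
  proof (cases r)
    case 0
    hence "B2 = {}" by (auto simp: B2_def B_def nb_walks_def)
    thus ?thesis using 0 by simp
  next
    case (Suc r')
    define C where "C = (SIGMA p:nb_walks r' a. {e \<in> out_arcs G a. p = [] \<or> hd p \<noteq> e})"
    have "card B2 = card C"
    proof (rule bij_betw_same_card[of "\<lambda>(e, p). (tl p, e)"], rule bij_betw_imageI)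
      show "inj_on (\<lambda>(e, p). (tl p, e)) B2"
        unfolding inj_on_def B2_def by (auto intro: list.expand)
      show "(\<lambda>(e, p). (tl p, e)) ` B2 = C"
      proof safe
        fix e p assume "(e, p) \<in> B2"
        hence p: "e \<in> out_arcs G a" "p \<in> nb_walks (Suc r') (head G e)" "p \<noteq> []" "hd p = arev e"
          using Suc by (auto simp: B2_def B_def)
        then obtain p' where p': "p = arev e # p'" by (cases p) auto
        show "(tl p, e) \<in> C"
          using p p' by (auto simp: C_def Cons_in_nb_walks)
      next
        fix p e assume "(p, e) \<in> C"
        hence "(e, arev e # p) \<in> B2"
          using a Suc by (auto simp: C_def B2_def B_def Cons_in_nb_walks)
        thus "(p, e) \<in> (\<lambda>(e, p). (tl p, e)) ` B2" by force
      qed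
    qed
    also have "\<dots> = (\<Sum>p\<in>nb_walks r' a. card {e \<in> out_arcs G a. p = [] \<or> hd p \<noteq> e})"
      unfolding C_def
      by (rule card_SigmaI) (auto simp: finite_nb_walks intro: finite_subset[OF _ finite_out_arcs[of a]])
    \<comment> \<open>An empty remainder forbids no arc, a nonempty one forbids exactly its own
      first arc.\<close>
    also have "\<dots> = (\<Sum>p\<in>nb_walks r' a. if r' = 0 then q + 1 else q)"
    proof (rule sum.cong[OF refl])
      fix p assume p: "p \<in> nb_walks r' a"
      show "card {e \<in> out_arcs G a. p = [] \<or> hd p \<noteq> e} = (if r' = 0 then q + 1 else q)"
      proof (cases r')
        case 0
        hence "p = []" using p by (simp add: nb_walks_def)
        thus ?thesis using 0 degree[OF a] by (simp add: out_arcs_def)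
      next
        case (Suc s)
        then obtain e p' where ep: "p = e # p'" using p nb_walks_SucE by blast
        hence "e \<in> out_arcs G a" using p Suc by (simp add: Cons_in_nb_walks)
        moreover have "{e' \<in> out_arcs G a. p = [] \<or> hd p \<noteq> e'} = out_arcs G a - {e}" using ep by auto
        ultimately show ?thesis using Suc degree[OF a] by (simp add: card_Diff_singleton)
      qed
    qed
    finally show ?thesis using Suc by (simp add: mult.commute)
  qed
  finally show ?thesis .
qed

lemma nb_count_0: "nb_count 0 = \<delta>"
  by (auto simp: nb_count_def nb_walks_0 \<delta>_def fun_eq_iff)

lemma nb_count_1: "nb_count (Suc 0) = adj (nb_count 0)"
proof
  fix a show "nb_count (Suc 0) a = adj (nb_count 0) a"
    using card_prepend[of a 0] by (cases "a \<in> verts G")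
      (simp_all add: nb_count_def adj_def nb_walks_outside flip: of_nat_sum)
qed

lemma nb_count_Suc_Suc:
  "nb_count (Suc (Suc r)) a = adj (nb_count (Suc r)) a - (if r = 0 then real q + 1 else real q) * nb_count r a"
  using card_prepend[of a "Suc r"] by (cases "a \<in> verts G")
    (simp_all add: nb_count_def adj_def nb_walks_outside flip: of_nat_sum)

lemma adj_eq_T: "adj f a = sqrt (real q) * T f a"
  using sqrt_q_pos by (simp add: T_def)

text \<open>Dividing the r-th count by (sqrt q)^r turns the factors q + 1 and q of
  \<open>nb_count_Suc_Suc\<close> into the factors 1 + 1/q and 1 of \<open>X_poly\<close>.\<close>

lemma nb_count_eq_poly_T: "nb_count r a = sqrt (real q) ^ r * poly_T (X_poly q r) a"
proof (induction r arbitrary: a rule: induct_nat_012)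
  case 0
  show ?case by (simp add: nb_count_0 poly_T_def)
next
  case 1
  have "poly_T [:1:] = \<delta>" by (simp add: poly_T_def fun_eq_iff)
  thus ?case by (simp add: nb_count_1 nb_count_0 adj_eq_T poly_T_pCons)
next
  case (ge2 r)
  have "nb_count (Suc r) = (\<lambda>a. sqrt (real q) ^ Suc r * poly_T (X_poly q (Suc r)) a)"
    using ge2 by (simp add: fun_eq_iff)
  hence "adj (nb_count (Suc r)) a = sqrt (real q) ^ Suc (Suc r) * T (poly_T (X_poly q (Suc r))) a"
    by (simp add: adj_eq_T T_smult)
  moreover have "T (poly_T (X_poly q (Suc r))) a = poly_T ([:0, 1:] * X_poly q (Suc r)) a"
    by (simp add: poly_T_pCons)
  moreover have "sqrt (real q) ^ Suc (Suc r) = real q * sqrt (real q) ^ r" by simp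
  ultimately show ?case using q_pos
    by (simp add: nb_count_Suc_Suc ge2 poly_T_diff poly_T_smult algebra_simps)
qed

theorem num_closed_nb_walks_eq:
  "real (num_closed_nb_walks G arev r v) = sqrt (real q) ^ r * L (X_poly q r)"
  using nb_count_eq_poly_T[of r v] by (simp add: nb_count_def nb_walks_def num_closed_nb_walks_def L_def)

end

section \<open>The Joukowski map and the generating function\<close>

text \<open>Convexity and openness of the ellipse are inherited from the disc through this linear
  rescaling.\<close>

lemma Omega_eq_vimage:
  assumes "\<rho> > 1"
  shows "Omega \<rho> = (\<lambda>w. Complex (Re w / (\<rho> + 1 / \<rho>)) (Im w / (\<rho> - 1 / \<rho>))) -` ball 0 1"
  by (auto simp: Omega_def cmod_def power_divide)

lemma linear_rescale: "linear (\<lambda>w. Complex (Re w / c) (Im w / d))"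
  by (rule linearI) (auto simp: complex_eq_iff add_divide_distrib)

lemma convex_Omega: "\<rho> > 1 \<Longrightarrow> convex (Omega \<rho>)"
  unfolding Omega_eq_vimage by (intro convex_linear_vimage linear_rescale convex_ball)

lemma open_Omega: "\<rho> > 1 \<Longrightarrow> open (Omega \<rho>)"
  unfolding Omega_eq_vimage
  by (intro open_vimage open_ball linear_continuous_on linear_conv_bounded_linear[THEN iffD1] linear_rescale)

text \<open>The circle |z| = s goes to the ellipse with semi-axes s + 1/s and |s - 1/s|, and both
  are smaller than those of \<open>Omega \<rho>\<close> when 1/\<rho> < s < \<rho>.\<close>

lemma joukowski_in_Omega:
  assumes \<rho>: "\<rho> > 1" and z: "1 / \<rho> < norm z" "norm z < \<rho>"
  shows "z + 1 / z \<in> Omega \<rho>"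
proof -
  define s where "s = norm z"
  have s: "s > 0" "1 / \<rho> < s" "s < \<rho>" using z \<rho> by (auto simp: s_def intro: less_trans[of 0 "1/\<rho>"])
  have sq: "s\<^sup>2 = (Re z)\<^sup>2 + (Im z)\<^sup>2" by (simp add: s_def cmod_power2)
  have rho_s: "1 < \<rho> * s" "s < \<rho>" using s \<rho> by (simp_all add: field_simps)
  have inv: "1 / z = cnj z / of_real (s\<^sup>2)"
    by (simp add: s_def complex_div_cnj[of 1] flip: of_real_power)
  have Re: "Re (z + 1 / z) = Re z / s * (s + 1 / s)"
    unfolding inv using s by (simp add: field_simps power2_eq_square)
  have Im: "Im (z + 1 / z) = Im z / s * (s - 1 / s)"
    unfolding inv using s by (simp add: field_simps power2_eq_square)
  define A where "A = ((s + 1 / s) / (\<rho> + 1 / \<rho>))\<^sup>2"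
  define B where "B = ((s - 1 / s) / (\<rho> - 1 / \<rho>))\<^sup>2"
  have "(\<rho> + 1 / \<rho>) - (s + 1 / s) = (\<rho> - s) * (\<rho> * s - 1) / (\<rho> * s)"
    using s \<rho> by (simp add: field_simps)
  moreover have "(\<rho> - s) * (\<rho> * s - 1) / (\<rho> * s) > 0" using rho_s s \<rho> by simp
  ultimately have "s + 1 / s < \<rho> + 1 / \<rho>" by linarith
  hence A: "A < 1" unfolding A_def using s \<rho>
    by (intro power_less_one_iff[THEN iffD2]) (auto simp: field_simps add_pos_pos)
  have e1: "(\<rho> - 1 / \<rho>) - (s - 1 / s) = (\<rho> - s) * (\<rho> * s + 1) / (\<rho> * s)"
    using s \<rho> by (simp add: field_simps)
  have e2: "(\<rho> - 1 / \<rho>) + (s - 1 / s) = (\<rho> + s) * (\<rho> * s - 1) / (\<rho> * s)"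
    using s \<rho> by (simp add: field_simps)
  have "0 < (\<rho> - 1 / \<rho>) - (s - 1 / s)" unfolding e1 using rho_s s \<rho> by (simp add: add_pos_pos)
  moreover have "0 < (\<rho> - 1 / \<rho>) + (s - 1 / s)" unfolding e2 using rho_s s \<rho> by simp
  ultimately have lt: "\<bar>s - 1 / s\<bar> < \<rho> - 1 / \<rho>" by (simp only: abs_less_iff) linarith
  hence "\<bar>(s - 1 / s) / (\<rho> - 1 / \<rho>)\<bar> < 1" by (simp add: abs_divide)
  hence B: "B < 1" unfolding B_def by (simp only: abs_square_less_1)
  have one: "(Re z / s)\<^sup>2 + (Im z / s)\<^sup>2 = 1"
    unfolding power_divide add_divide_distrib[symmetric] sq[symmetric] using s by simp
  have "(Re (z + 1 / z))\<^sup>2 / (\<rho> + 1 / \<rho>)\<^sup>2 + (Im (z + 1 / z))\<^sup>2 / (\<rho> - 1 / \<rho>)\<^sup>2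
      = (Re z / s)\<^sup>2 * A + (Im z / s)\<^sup>2 * B"
    unfolding Re Im A_def B_def by (simp only: power_mult_distrib power_divide times_divide_eq_right)
  \<comment> \<open>By \<open>one\<close> the left side is a convex combination of \<open>A\<close>
    and \<open>B\<close>.\<close>
  also have "\<dots> \<le> (Re z / s)\<^sup>2 * max A B + (Im z / s)\<^sup>2 * max A B"
    by (intro add_mono mult_left_mono) auto
  also have "\<dots> = max A B" using one by (simp flip: distrib_right)
  also have "\<dots> < 1" using A B by simp
  finally show ?thesis by (simp add: Omega_def)
qed

text \<open>The roots of a + 1/a = x are conjugate on the unit circle for |x| \<le> 2 and real
  otherwise. Keeping both gives the factorisation 1 - x z + z^2 = (1 - a z)(1 - b z).\<close>

lemma real_joukowski:
  assumes s: "s \<ge> 1" and x: "\<bar>x\<bar> \<le> s + 1 / s"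
  obtains a b :: complex where "a * b = 1" "a + b = of_real x" "norm a \<le> s" "norm b \<le> s"
proof (cases "\<bar>x\<bar> \<le> 2")
  case True
  define y where "y = sqrt (1 - (x / 2)\<^sup>2)"
  have "(x / 2)\<^sup>2 \<le> 1" using True by (simp add: abs_square_le_1)
  hence y: "(x / 2)\<^sup>2 + y\<^sup>2 = 1" by (simp add: y_def)
  show ?thesis
  proof (rule that[of "Complex (x / 2) y" "Complex (x / 2) (- y)"])
    show "Complex (x / 2) y * Complex (x / 2) (- y) = 1"
      using y by (simp add: complex_eq_iff power2_eq_square)
  qed (use y s in \<open>auto simp: complex_eq_iff cmod_def\<close>)
next
  case False
  have "\<exists>t\<ge>1. t \<le> s \<and> t + 1 / t = \<bar>x\<bar>"
    by (rule IVT) (use False s x in \<open>auto intro!: continuous_intros\<close>)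
  then obtain t where t: "t \<ge> 1" "t \<le> s" "t + 1 / t = \<bar>x\<bar>" by blast
  have "1 / t \<le> 1" using t by simp
  hence t': "1 / t \<le> s" using s by linarith
  show ?thesis
  proof (rule that[of "of_real (sgn x * t)" "of_real (sgn x / t)"])
    have "sgn x * sgn x = 1" using False by (auto simp: sgn_if)
    thus "complex_of_real (sgn x * t) * complex_of_real (sgn x / t) = 1"
      using t(1) by (simp flip: of_real_mult)
    have "sgn x * t + sgn x / t = sgn x * (t + 1 / t)" by (simp add: algebra_simps)
    also have "\<dots> = x" by (simp add: t(3) mult.commute abs_mult_sgn)
    finally show "complex_of_real (sgn x * t) + complex_of_real (sgn x / t) = of_real x"
      by (simp only: flip: of_real_add)
  qed (use t t' False in \<open>auto simp: norm_mult norm_divide sgn_if\<close>)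
qed

text \<open>The complete homogeneous symmetric polynomial (a^(r+1) - b^(r+1))/(a - b), as a sum so
  that a = b (that is, x = 2 or x = -2) is covered. For a b = 1 it is the Chebyshev polynomial U_r
  at (a+b)/2.\<close>

definition hsum :: "complex \<Rightarrow> complex \<Rightarrow> nat \<Rightarrow> complex" where
  "hsum a b r = (\<Sum>j\<le>r. a ^ j * b ^ (r - j))"

lemma hsum_Suc: "hsum a b (Suc r) = a * hsum a b r + b ^ Suc r"
  unfolding hsum_def by (simp add: sum.atMost_Suc_shift sum_distrib_left mult_ac del: sum.atMost_Suc)

lemma hsum_Suc_Suc:
  assumes "a * b = 1"
  shows "hsum a b (Suc (Suc r)) = (a + b) * hsum a b (Suc r) - hsum a b r"
proof -
  have "b * hsum a b (Suc r) = a * b * hsum a b r + b ^ Suc (Suc r)"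
    by (subst hsum_Suc) (simp add: algebra_simps)
  thus ?thesis using hsum_Suc[of a b "Suc r"] assms by (simp add: algebra_simps)
qed

lemma norm_hsum_le:
  assumes "norm a \<le> s" "norm b \<le> s"
  shows "norm (hsum a b r) \<le> real (Suc r) * s ^ r"
proof -
  have "norm (hsum a b r) \<le> (\<Sum>j\<le>r. s ^ r)" unfolding hsum_def
  proof (rule sum_norm_le)
    fix j assume "j \<in> {..r}"
    hence "s ^ r = s ^ j * s ^ (r - j)" by (simp flip: power_add)
    thus "norm (a ^ j * b ^ (r - j)) \<le> s ^ r"
      using assms order_trans[OF norm_ge_zero assms(1)]
      by (auto simp: norm_mult norm_power intro!: mult_mono power_mono)
  qed
  thus ?thesis by simp
qed

text \<open>X_r = U_r - U_(r-2)/q, as the generating function suggests. The exceptional factor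
  enters X_2 and the correction is still absent from X_1, so the steps to X_2 and X_3 are separate
  cases.\<close>

lemma X_fun_eq_hsum:
  assumes "a * b = 1" "a + b = of_real x"
  shows "of_real (X_fun r q x) = hsum a b r - (if r < 2 then 0 else hsum a b (r - 2) / of_nat q)"
proof (induction r rule: induct_nat_012)
  case 0 show ?case by (simp add: X_fun_eq_poly hsum_def)
next
  case 1 show ?case using assms by (simp add: X_fun_eq_poly hsum_def add.commute)
next
  case (ge2 r)
  have h1: "hsum a b (Suc 0) = of_real x" using assms by (simp add: hsum_def add.commute)
  have h0: "hsum a b 0 = 1" by (simp add: hsum_def)
  have rec: "complex_of_real (X_fun (Suc (Suc r)) q x)
     = of_real x * of_real (X_fun (Suc r) q x)
        - (if r = 0 then 1 + 1 / of_nat q else 1) * of_real (X_fun r q x)"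
    by (simp add: X_fun_eq_poly)
  consider "r = 0" | "r = 1" | k where "r = Suc (Suc k)" by (metis One_nat_def not0_implies_Suc)
  thus ?case
  proof cases
    case 3
    have "hsum a b r * inverse (of_nat q) = (of_real x * hsum a b (Suc k) - hsum a b k) * inverse (of_nat q)"
      using hsum_Suc_Suc[OF assms(1), of k] assms(2) 3 by simp
    with 3 show ?thesis unfolding rec ge2 hsum_Suc_Suc[OF assms(1), of r] assms(2)
      by (simp add: algebra_simps divide_inverse)
  next
    case 1
    thus ?thesis unfolding rec ge2
      using hsum_Suc_Suc[OF assms(1), of 0] assms(2) h0 h1 by (simp add: algebra_simps)
  next
    case 2
    thus ?thesis unfolding rec ge2
      using hsum_Suc_Suc[OF assms(1), of 1] assms(2) h0 h1 by (simp add: algebra_simps)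
  qed
qed

text \<open>On this interval both roots have modulus at most sqrt q, so each of the two terms in
  \<open>X_fun_eq_hsum\<close> has at most r + 1 summands, each of modulus at most q^(r/2).\<close>

lemma X_fun_bound:
  assumes q: "q \<ge> 1" and x: "\<bar>x\<bar> \<le> sqrt (real q) + 1 / sqrt (real q)"
  shows "\<bar>X_fun r q x\<bar> \<le> 2 * real (Suc r) * sqrt (real q) ^ r"
proof -
  define s where "s = sqrt (real q)"
  have s: "s \<ge> 1" using q by (simp add: s_def)
  obtain a b :: complex where ab: "a * b = 1" "a + b = of_real x" "norm a \<le> s" "norm b \<le> s"
    using real_joukowski[OF s] x unfolding s_def by metis
  have "norm (if r < 2 then 0 else hsum a b (r - 2) / of_nat q) \<le> real (Suc r) * s ^ r"
  proof (cases "r < 2")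
    case False
    have "norm (hsum a b (r - 2) / of_nat q) \<le> norm (hsum a b (r - 2))"
      using q mult_left_mono[of 1 "real q" "norm (hsum a b (r - 2))"] by (simp add: norm_divide divide_le_eq)
    also have "\<dots> \<le> real (Suc (r - 2)) * s ^ (r - 2)" by (rule norm_hsum_le) (use ab in auto)
    also have "\<dots> \<le> real (Suc r) * s ^ r" using s by (intro mult_mono power_increasing) auto
    finally show ?thesis using False by simp
  qed (use s in simp)
  moreover have "norm (hsum a b r) \<le> real (Suc r) * s ^ r" by (rule norm_hsum_le) (use ab in auto)
  moreover have "norm (complex_of_real (X_fun r q x)) \<le> norm (hsum a b r) + norm (if r < 2 then 0 else hsum a b (r - 2) / of_nat q)"
    unfolding X_fun_eq_hsum[OF ab(1,2)] by (rule norm_triangle_ineq4)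
  ultimately have "norm (complex_of_real (X_fun r q x)) \<le> 2 * (real (Suc r) * s ^ r)" by linarith
  thus ?thesis by (simp only: norm_of_real s_def mult.assoc)
qed

text \<open>For |z| < 1/sqrt q both |a z| and |b z| are below 1, so 1/((1 - a z)(1 - b z)) is a
  Cauchy product of geometric series; multiplying by 1 - z^2/q shifts it by two.\<close>

lemma generating_function:
  fixes z :: complex
  assumes q: "q \<ge> 1" and x: "\<bar>x\<bar> \<le> sqrt (real q) + 1 / sqrt (real q)"
    and z: "norm z < 1 / sqrt (real q)"
  shows "1 - of_real x * z + z\<^sup>2 \<noteq> 0"
    and "(\<lambda>r. of_real (X_fun r q x) * z ^ r) sums ((1 - z\<^sup>2 / of_nat q) / (1 - of_real x * z + z\<^sup>2))"
proof -
  define s where "s = sqrt (real q)"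
  have s: "s \<ge> 1" using q by (simp add: s_def)
  obtain a b :: complex where ab: "a * b = 1" "a + b = of_real x" "norm a \<le> s" "norm b \<le> s"
    using real_joukowski[OF s] x unfolding s_def by metis
  have less1: "norm (c * z) < 1" if "norm c \<le> s" for c
  proof -
    have "norm c * norm z \<le> s * norm z" using that by (intro mult_right_mono) auto
    also have "s * norm z < 1" using z s by (simp add: s_def field_simps)
    finally show ?thesis by (simp add: norm_mult)
  qed
  have fac: "1 - of_real x * z + z\<^sup>2 = (1 - a * z) * (1 - b * z)"
  proof -
    have "(1 - a * z) * (1 - b * z) = 1 - (a + b) * z + (a * b) * z\<^sup>2"
      by (simp add: algebra_simps power2_eq_square)
    thus ?thesis using ab by simp
  qed
  have nz: "a * z \<noteq> 1" "b * z \<noteq> 1" using less1[OF ab(3)] less1[OF ab(4)] by auto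
  thus "1 - of_real x * z + z\<^sup>2 \<noteq> 0" unfolding fac by simp
  define H where "H = 1 / ((1 - a * z) * (1 - b * z))"
  have "(\<lambda>r. \<Sum>i\<le>r. (a * z) ^ i * (b * z) ^ (r - i)) sums ((\<Sum>r. (a * z) ^ r) * (\<Sum>r. (b * z) ^ r))"
    by (rule Cauchy_product_sums)
       (use less1[OF ab(3)] less1[OF ab(4)] in \<open>auto simp: norm_power norm_mult[symmetric] intro!: summable_geometric\<close>)
  also have "(\<lambda>r. \<Sum>i\<le>r. (a * z) ^ i * (b * z) ^ (r - i)) = (\<lambda>r. hsum a b r * z ^ r)"
  proof
    fix r
    have "(a * z) ^ i * (b * z) ^ (r - i) = a ^ i * b ^ (r - i) * z ^ r" if "i \<le> r" for i
      using that by (simp add: power_mult_distrib mult_ac flip: power_add)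
    thus "(\<Sum>i\<le>r. (a * z) ^ i * (b * z) ^ (r - i)) = hsum a b r * z ^ r"
      by (simp add: hsum_def sum_distrib_right)
  qed
  finally have H: "(\<lambda>r. hsum a b r * z ^ r) sums H"
    using less1[OF ab(3)] less1[OF ab(4)] by (simp add: suminf_geometric H_def)
  hence "(\<lambda>r. z\<^sup>2 / of_nat q * (hsum a b r * z ^ r)) sums (z\<^sup>2 / of_nat q * H)" by (rule sums_mult)
  moreover define f where "f r = (if r < 2 then 0 else hsum a b (r - 2) / of_nat q) * z ^ r" for r
  have "z\<^sup>2 / of_nat q * (hsum a b r * z ^ r) = f (r + 2)" for r
    by (simp add: f_def power_add mult_ac power2_eq_square)
  ultimately have "(\<lambda>r. f (r + 2)) sums (z\<^sup>2 / of_nat q * H)" by simp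
  hence "f sums (z\<^sup>2 / of_nat q * H + (\<Sum>i<2. f i))" by (simp only: sums_iff_shift)
  hence "(\<lambda>r. (if r < 2 then 0 else hsum a b (r - 2) / of_nat q) * z ^ r) sums (z\<^sup>2 / of_nat q * H)"
    by (simp add: f_def[abs_def])
  from sums_diff[OF H this]
  show "(\<lambda>r. of_real (X_fun r q x) * z ^ r) sums ((1 - z\<^sup>2 / of_nat q) / (1 - of_real x * z + z\<^sup>2))"
    unfolding X_fun_eq_hsum[OF ab(1,2)] fac by (simp add: H_def algebra_simps diff_divide_distrib)
qed

section \<open>Expansion by Cauchy integrals\<close>

text \<open>With w = z + 1/z write h(w) = h(x) + (w - x) \<open>\<phi>\<close>(w). The quotient
  \<open>\<phi>\<close> has a primitive on the convex set \<open>Omega \<rho>\<close>, whose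
  pullback kills its contour integral; the constant h(x) is left to Cauchy's formula at z = 0. The
  contour thus stays a circle in the z-plane.\<close>

lemma cauchy_joukowski:
  assumes \<rho>: "\<rho> > 1" and h: "h holomorphic_on Omega \<rho>" and \<tau>: "1 / \<rho> < \<tau>" "\<tau> < 1"
    and x: "x \<in> Omega \<rho>" and nz: "\<And>z. norm z \<le> \<tau> \<Longrightarrow> 1 - x * z + z\<^sup>2 \<noteq> 0"
  shows "((\<lambda>z. h (z + 1 / z) * ((1 - z\<^sup>2) / (1 - x * z + z\<^sup>2)) / z) has_contour_integral 2 * pi * \<i> * h x)
           (circlepath 0 \<tau>)"
proof -
  have \<tau>0: "\<tau> > 0" using \<tau> \<rho> by (meson less_trans zero_less_divide_1_iff zero_less_one)
  define \<phi> where "\<phi> w = (if w = x then deriv h x else h w / (w - x) - h x / (w - x))" for w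
  have "\<phi> holomorphic_on Omega \<rho>" unfolding \<phi>_def
    by (rule pole_theorem_open[OF h open_Omega[OF \<rho>]]) auto
  then obtain \<Phi> where \<Phi>: "\<And>w. w \<in> Omega \<rho> \<Longrightarrow> (\<Phi> has_field_derivative \<phi> w) (at w within Omega \<rho>)"
    using holomorphic_convex_primitive'[OF convex_Omega[OF \<rho>] open_Omega[OF \<rho>]] by blast
  define S where "S = {z :: complex. 1 / \<rho> < norm z \<and> norm z < \<rho>}"
  have circ: "path_image (circlepath 0 \<tau>) \<subseteq> S"
    using \<tau> \<tau>0 \<rho> by (auto simp: S_def dist_norm)
  have "((\<lambda>z. \<phi> (z + 1 / z) * (1 - 1 / z\<^sup>2)) has_contour_integral 0) (circlepath 0 \<tau>)"
  proof (rule Cauchy_theorem_primitive[where f = "\<lambda>z. \<Phi> (z + 1 / z)" and S = S])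
    fix z assume z: "z \<in> S"
    hence z0: "z \<noteq> 0" using \<rho> by (auto simp: S_def)
    have "z + 1 / z \<in> Omega \<rho>" using z joukowski_in_Omega[OF \<rho>] by (simp add: S_def)
    hence "(\<Phi> has_field_derivative \<phi> (z + 1 / z)) (at (z + 1 / z))"
      using \<Phi> open_Omega[OF \<rho>] at_within_open by metis
    moreover have "((\<lambda>z. z + 1 / z) has_field_derivative 1 - 1 / z\<^sup>2) (at z within S)"
      using z0 by (auto intro!: derivative_eq_intros simp: power2_eq_square)
    ultimately show "((\<lambda>z. \<Phi> (z + 1 / z)) has_field_derivative \<phi> (z + 1 / z) * (1 - 1 / z\<^sup>2)) (at z within S)"
      by (rule DERIV_chain2)
  qed (use circ in auto)
  \<comment> \<open>The sign reflects dw/(w - x) = -(1 - z^2)/(1 - x z + z^2) dz/z: a circle of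
    radius below 1 is mapped to an ellipse run clockwise.\<close>
  hence A: "((\<lambda>z. - (\<phi> (z + 1 / z) * (1 - 1 / z\<^sup>2))) has_contour_integral - 0) (circlepath 0 \<tau>)"
    by (rule has_contour_integral_neg)
  define F where "F z = (1 - z\<^sup>2) / (1 - x * z + z\<^sup>2)" for z
  have "F holomorphic_on cball 0 \<tau>" unfolding F_def
    by (intro holomorphic_intros) (use nz in auto)
  from Cauchy_integral_circlepath_simple[OF this, of 0]
  have "((\<lambda>z. F z / z) has_contour_integral 2 * pi * \<i>) (circlepath 0 \<tau>)"
    using \<tau>0 by (simp add: F_def)
  from has_contour_integral_lmul[OF this, of "h x"]
  have "((\<lambda>z. h x * (F z / z)) has_contour_integral h x * (2 * pi * \<i>)) (circlepath 0 \<tau>)" .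
  from has_contour_integral_add[OF A this]
  have "((\<lambda>z. - (\<phi> (z + 1 / z) * (1 - 1 / z\<^sup>2)) + h x * (F z / z)) has_contour_integral 2 * pi * \<i> * h x) (circlepath 0 \<tau>)"
    by (simp add: mult_ac)
  thus ?thesis
  proof (rule has_contour_integral_eq)
    fix z assume "z \<in> path_image (circlepath 0 \<tau>)"
    hence z: "norm z = \<tau>" "z \<noteq> 0" using \<tau>0 by auto
    define D where "D = 1 - x * z + z\<^sup>2"
    have D: "D \<noteq> 0" using nz[of z] z by (simp add: D_def)
    have zx: "z + 1 / z - x = D / z" using z by (simp add: D_def field_simps power2_eq_square)
    hence neq: "z + 1 / z \<noteq> x" using D z by auto
    have \<phi>_eq: "\<phi> (z + 1 / z) = (h (z + 1 / z) - h x) / (D / z)"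
      unfolding \<phi>_def zx if_not_P[OF neq] diff_divide_distrib ..
    have "- ((A - B) / (D / z) * (1 - 1 / z\<^sup>2)) + B * ((1 - z\<^sup>2) / D / z) = A * ((1 - z\<^sup>2) / D) / z" for A B
      using z D by (simp add: field_simps power2_eq_square)
    thus "- (\<phi> (z + 1 / z) * (1 - 1 / z\<^sup>2)) + h x * (F z / z) = h (z + 1 / z) * ((1 - z\<^sup>2) / (1 - x * z + z\<^sup>2)) / z"
      unfolding F_def \<phi>_eq D_def[symmetric] .
  qed
qed

text \<open>On the unit circle \<open>Re (kern q z * z\<^sup>r)\<close> is, up to a constant, \<open>X\<^sub>r\<close> times the
  Kesten--McKay density in the variable \<open>t = arg z\<close>.  For \<open>q = 1\<close> numerator and denominator
  cancel, which removes the singularities at \<open>1\<close> and \<open>-1\<close>.\<close>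

definition kern :: "nat \<Rightarrow> complex \<Rightarrow> complex" where
  "kern q z = (if q = 1 then 1 else (1 - z\<^sup>2) / (1 - z\<^sup>2 / of_nat q))"

text \<open>The factor \<open>kern q\<close> cancels the numerator 1 - z^2/q of the generating
  function and leaves the 1 - z^2 of \<open>cauchy_joukowski\<close>.\<close>

definition circle_coeff :: "nat \<Rightarrow> real \<Rightarrow> (complex \<Rightarrow> complex) \<Rightarrow> nat \<Rightarrow> complex" where
  "circle_coeff q \<tau> h r =
     contour_integral (circlepath 0 \<tau>) (\<lambda>z. h (z + 1 / z) * kern q z * z ^ r / z) / (2 * pi * \<i>)"

lemma kern_denominator_nz:
  fixes z :: complex
  assumes "norm z < sqrt (real q)" shows "1 - z\<^sup>2 / of_nat q \<noteq> 0"
proof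
  assume "1 - z\<^sup>2 / of_nat q = 0"
  hence eq: "z\<^sup>2 / of_nat q = 1" by simp
  hence "of_nat q \<noteq> (0 :: complex)" by auto
  hence "z\<^sup>2 = of_nat q" using eq by (simp add: field_simps)
  hence "norm z ^ 2 = real q" by (metis norm_of_nat norm_power)
  moreover have "norm z ^ 2 < sqrt (real q) ^ 2" using assms by (intro power_strict_mono) auto
  ultimately show False by simp
qed

text \<open>For q > 1 the poles sqrt q and -sqrt q lie outside the closed unit disc, which leaves
  room to move the contour to |z| = 1.\<close>

definition kern_domain :: "nat \<Rightarrow> complex set" where
  "kern_domain q = (if q = 1 then UNIV else ball 0 (sqrt (real q)))"

lemma kern_holomorphic: "kern q holomorphic_on kern_domain q"
proof (cases "q = 1")
  case False
  have "(\<lambda>z. (1 - z\<^sup>2) / (1 - z\<^sup>2 / of_nat q)) holomorphic_on ball 0 (sqrt (real q))"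
  proof (cases "q = 0")
    case False
    thus ?thesis
      by (intro holomorphic_intros) (simp, rule kern_denominator_nz, simp)
  qed (simp add: holomorphic_on_def)
  thus ?thesis using False by (simp add: kern_def[abs_def] kern_domain_def)
qed (simp add: kern_def[abs_def] kern_domain_def)

lemma cball_1_subset_kern_domain:
  assumes "q \<ge> 1" shows "cball 0 1 \<subseteq> kern_domain q"
proof (cases "q = 1")
  case False
  hence "1 < sqrt (real q)" using assms by simp
  hence "norm z < sqrt (real q)" if "norm z \<le> 1" for z :: complex using that by (rule le_less_trans[rotated])
  thus ?thesis by (auto simp: kern_domain_def)
qed (simp add: kern_domain_def)

lemma continuous_on_kern_cis:
  assumes "q \<ge> 1" shows "continuous_on UNIV (\<lambda>t. kern q (cis t))"
proof -
  have "continuous_on UNIV (kern q \<circ> cis)"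
  proof (rule continuous_on_compose)
    show "continuous_on (range cis) (kern q)"
      by (rule continuous_on_subset[OF holomorphic_on_imp_continuous_on[OF kern_holomorphic]])
         (use cball_1_subset_kern_domain[OF assms] in auto)
  qed (intro continuous_intros)
  thus ?thesis by (simp add: o_def)
qed

lemma integrand_holomorphic:
  assumes \<rho>: "\<rho> > 1" and h: "h holomorphic_on Omega \<rho>"
  shows "(\<lambda>z. h (z + 1 / z) * kern q z * z ^ r / z) holomorphic_on
           ({z. 1 / \<rho> < norm z \<and> norm z < \<rho>} \<inter> kern_domain q)" (is "_ holomorphic_on ?S")
proof -
  have "h \<circ> (\<lambda>z. z + 1 / z) holomorphic_on ?S"
  proof (rule holomorphic_on_compose_gen[OF _ h])
    show "(\<lambda>z. z + 1 / z) holomorphic_on ?S"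
      by (intro holomorphic_intros) (use \<rho> in auto)
    show "(\<lambda>z. z + 1 / z) ` ?S \<subseteq> Omega \<rho>" using joukowski_in_Omega[OF \<rho>] by auto
  qed
  thus ?thesis unfolding o_def
    by (intro holomorphic_intros holomorphic_on_subset[OF kern_holomorphic]) (use \<rho> in auto)
qed

text \<open>The bound on the integrand serves uniform convergence on the circle; the bound on the
  coefficients serves integration term by term against the spectral measure.\<close>

lemma circle_coeff_bound:
  assumes q: "q \<ge> 1" and \<rho>: "\<rho> > 1" and h: "h holomorphic_on Omega \<rho>" and \<tau>: "1 / \<rho> < \<tau>" "\<tau> < 1"
  shows "\<exists>C\<ge>0. (\<forall>z. norm z = \<tau> \<longrightarrow> norm (h (z + 1 / z) * kern q z / z) \<le> C) \<and>
    (\<forall>r. norm (circle_coeff q \<tau> h r) \<le> C * \<tau> * \<tau> ^ r)"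
proof -
  have \<tau>0: "\<tau> > 0" using \<tau> \<rho> by (meson less_trans zero_less_divide_1_iff zero_less_one)
  have sub: "sphere 0 \<tau> \<subseteq> {z. 1 / \<rho> < norm z \<and> norm z < \<rho>} \<inter> kern_domain q"
  proof -
    have "sphere 0 \<tau> \<subseteq> cball (0::complex) 1" using \<tau> by auto
    thus ?thesis using cball_1_subset_kern_domain[OF q] \<tau> \<rho> by fastforce
  qed
  have cont: "continuous_on (sphere 0 \<tau>) (\<lambda>z. h (z + 1 / z) * kern q z * z ^ r / z)" for r
    by (rule continuous_on_subset[OF holomorphic_on_imp_continuous_on[OF integrand_holomorphic[OF \<rho> h]] sub])
  have "bounded ((\<lambda>z. h (z + 1 / z) * kern q z * z ^ 0 / z) ` sphere 0 \<tau>)"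
    by (intro compact_imp_bounded compact_continuous_image cont) simp
  then obtain C where C: "C > 0" "\<And>z. norm z = \<tau> \<Longrightarrow> norm (h (z + 1 / z) * kern q z / z) \<le> C"
    unfolding bounded_pos by auto
  have "norm (circle_coeff q \<tau> h r) \<le> C * \<tau> * \<tau> ^ r" for r
  proof -
    have "(\<lambda>z. h (z + 1 / z) * kern q z * z ^ r / z) contour_integrable_on circlepath 0 \<tau>"
      by (rule contour_integrable_continuous_circlepath) (use cont \<tau>0 in simp)
    hence "norm (contour_integral (circlepath 0 \<tau>) (\<lambda>z. h (z + 1 / z) * kern q z * z ^ r / z))
        \<le> (C * \<tau> ^ r) * (2 * pi * \<tau>)"
    proof (rule has_contour_integral_bound_circlepath[OF has_contour_integral_integral])
      fix z :: complex assume z: "norm (z - 0) = \<tau>"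
      have "norm (h (z + 1 / z) * kern q z * z ^ r / z) = norm (h (z + 1 / z) * kern q z / z) * \<tau> ^ r"
        using z by (simp add: norm_mult norm_divide norm_power)
      also have "\<dots> \<le> C * \<tau> ^ r" using C(2)[of z] z \<tau>0 by (intro mult_right_mono) auto
      finally show "norm (h (z + 1 / z) * kern q z * z ^ r / z) \<le> C * \<tau> ^ r" .
    qed (use C \<tau>0 in auto)
    thus ?thesis by (simp add: circle_coeff_def norm_divide norm_mult field_simps)
  qed
  thus ?thesis using C by (intro exI[of _ C]) auto
qed

lemma summable_majorant:
  fixes y :: real assumes "0 \<le> y" "y < 1"
  shows "summable (\<lambda>r. real (Suc r) * y ^ r)"
  using geometric_deriv_sums[of y] assms by (simp add: sums_iff)

text \<open>The root a from \<open>real_joukowski\<close> satisfies 1/\<rho> < |a| < \<rho>. For s =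
  sqrt q this puts the support of every spectral measure inside \<open>Omega \<rho>\<close>.\<close>

lemma of_real_in_Omega:
  assumes s: "s \<ge> 1" and \<rho>: "\<rho> > s" and x: "\<bar>x\<bar> \<le> s + 1 / s"
  shows "of_real x \<in> Omega \<rho>"
proof -
  obtain a b :: complex where ab: "a * b = 1" "a + b = of_real x" "norm a \<le> s" "norm b \<le> s"
    using real_joukowski[OF s x] by blast
  have a0: "a \<noteq> 0" using ab by auto
  hence b: "b = 1 / a" using ab by (simp add: field_simps)
  have "1 / norm a < \<rho>" using ab b \<rho> by (simp add: norm_divide)
  hence "1 / \<rho> < norm a" using a0 s \<rho> by (simp add: field_simps)
  hence "a + 1 / a \<in> Omega \<rho>" using ab s \<rho> by (intro joukowski_in_Omega) auto
  thus ?thesis using ab b by simp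
qed

theorem X_fun_expansion:
  assumes q: "q \<ge> 1" and \<rho>: "\<rho> > sqrt (real q)" and h: "h holomorphic_on Omega \<rho>"
    and \<tau>: "1 / \<rho> < \<tau>" "\<tau> < 1 / sqrt (real q)"
    and x: "\<bar>x\<bar> \<le> sqrt (real q) + 1 / sqrt (real q)"
  shows "(\<lambda>r. circle_coeff q \<tau> h r * of_real (X_fun r q x)) sums h (of_real x)"
proof -
  have sq1: "sqrt (real q) \<ge> 1" using q by simp
  have \<rho>1: "\<rho> > 1" using \<rho> sq1 by linarith
  have "1 / sqrt (real q) \<le> 1" using q by simp
  hence \<tau>1: "\<tau> < 1" using \<tau> by linarith
  have \<tau>0: "\<tau> > 0" using \<tau> \<rho>1 by (meson less_trans zero_less_divide_1_iff zero_less_one)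
  have y1: "sqrt (real q) * \<tau> < 1" using \<tau>(2) sq1 by (simp add: field_simps)
  obtain C where C: "C \<ge> 0" "\<And>z. norm z = \<tau> \<Longrightarrow> norm (h (z + 1 / z) * kern q z / z) \<le> C"
    using circle_coeff_bound[OF q \<rho>1 h \<tau>(1) \<tau>1] by blast
  have gf: "(\<lambda>r. of_real (X_fun r q x) * z ^ r) sums ((1 - z\<^sup>2 / of_nat q) / (1 - of_real x * z + z\<^sup>2))"
    "1 - of_real x * z + z\<^sup>2 \<noteq> 0" if "norm z \<le> \<tau>" for z :: complex
    using generating_function[OF q x, of z] that \<tau> by auto
  have xO: "of_real x \<in> Omega \<rho>" by (rule of_real_in_Omega[OF sq1 \<rho> x])
  define G where "G r z = h (z + 1 / z) * kern q z * z ^ r / z * of_real (X_fun r q x)" for r z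
  have sub: "sphere 0 \<tau> \<subseteq> {z. 1 / \<rho> < norm z \<and> norm z < \<rho>} \<inter> kern_domain q"
  proof -
    have "sphere 0 \<tau> \<subseteq> cball (0::complex) 1" using \<tau>1 by auto
    thus ?thesis using cball_1_subset_kern_domain[OF q] \<tau> \<tau>1 \<rho>1 by fastforce
  qed
  have intbl0: "(\<lambda>z. h (z + 1 / z) * kern q z * z ^ r / z) contour_integrable_on circlepath 0 \<tau>" for r
    by (rule contour_integrable_continuous_circlepath)
       (use \<tau>0 continuous_on_subset[OF holomorphic_on_imp_continuous_on[OF integrand_holomorphic[OF \<rho>1 h]] sub] in simp)
  hence intbl: "G r contour_integrable_on circlepath 0 \<tau>" for r
    unfolding G_def by (intro contour_integrable_rmul)
  have intG: "contour_integral (circlepath 0 \<tau>) (G r) = 2 * pi * \<i> * (circle_coeff q \<tau> h r * of_real (X_fun r q x))" for r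
    unfolding G_def contour_integral_rmul[OF intbl0] by (simp add: circle_coeff_def)
  have unif: "uniform_limit (sphere 0 \<tau>) (\<lambda>n z. \<Sum>i<n. G i z) (\<lambda>z. \<Sum>i. G i z) sequentially"
  \<comment> \<open>The growth of X_r is beaten by \<tau>^r because sqrt q times \<tau> is below
    1.\<close>
  proof (rule Weierstrass_m_test[where M = "\<lambda>r. 2 * C * (real (Suc r) * (sqrt (real q) * \<tau>) ^ r)"])
    show "summable (\<lambda>r. 2 * C * (real (Suc r) * (sqrt (real q) * \<tau>) ^ r))"
      using \<tau>0 y1 by (intro summable_mult summable_majorant) auto
    fix r and z :: complex assume "z \<in> sphere 0 \<tau>"
    hence z: "norm z = \<tau>" by simp
    have "norm (G r z) = norm (h (z + 1 / z) * kern q z / z) * (\<tau> ^ r * \<bar>X_fun r q x\<bar>)"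
      using z by (simp add: G_def norm_mult norm_divide norm_power)
    also have "\<dots> \<le> C * (\<tau> ^ r * (2 * real (Suc r) * sqrt (real q) ^ r))"
      using C z \<tau>0 by (intro mult_mono X_fun_bound[OF q x]) auto
    finally show "norm (G r z) \<le> 2 * C * (real (Suc r) * (sqrt (real q) * \<tau>) ^ r)"
      by (simp add: power_mult_distrib algebra_simps)
  qed
  have "(\<lambda>n. contour_integral (circlepath 0 \<tau>) (\<lambda>z. \<Sum>i<n. G i z))
      \<longlonglongrightarrow> contour_integral (circlepath 0 \<tau>) (\<lambda>z. \<Sum>i. G i z)"
    by (rule contour_integral_uniform_limit_circlepath[OF _ unif])
       (use \<tau>0 in \<open>auto intro!: always_eventually contour_integrable_sum intbl\<close>)
  moreover have "contour_integral (circlepath 0 \<tau>) (\<lambda>z. \<Sum>i<n. G i z)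
      = 2 * pi * \<i> * (\<Sum>i<n. circle_coeff q \<tau> h i * of_real (X_fun i q x))" for n
    by (subst contour_integral_sum) (simp_all add: intbl intG sum_distrib_left)
  moreover have "contour_integral (circlepath 0 \<tau>) (\<lambda>z. \<Sum>i. G i z) = 2 * pi * \<i> * h (of_real x)"
  proof -
    have "((\<lambda>z. \<Sum>i. G i z) has_contour_integral 2 * pi * \<i> * h (of_real x)) (circlepath 0 \<tau>)"
    proof (rule has_contour_integral_eq[OF cauchy_joukowski[OF \<rho>1 h \<tau>(1) \<tau>1 xO]])
      show "1 - of_real x * z + z\<^sup>2 \<noteq> 0" if "norm z \<le> \<tau>" for z :: complex using gf(2)[OF that] .
      fix z assume "z \<in> path_image (circlepath 0 \<tau>)"
      hence z: "norm z = \<tau>" "z \<noteq> 0" using \<tau>0 by auto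
      have "z \<in> kern_domain q" using z \<tau>1 cball_1_subset_kern_domain[OF q] by auto
      hence k: "kern q z * (1 - z\<^sup>2 / of_nat q) = 1 - z\<^sup>2"
        using kern_denominator_nz[of z q] by (cases "q = 1") (simp_all add: kern_def kern_domain_def)
      have "(\<lambda>r. h (z + 1 / z) * kern q z / z * (of_real (X_fun r q x) * z ^ r)) sums
        (h (z + 1 / z) * kern q z / z * ((1 - z\<^sup>2 / of_nat q) / (1 - of_real x * z + z\<^sup>2)))"
        by (rule sums_mult) (rule gf, simp add: z)
      also have "(\<lambda>r. h (z + 1 / z) * kern q z / z * (of_real (X_fun r q x) * z ^ r)) = (\<lambda>r. G r z)"
        by (simp add: G_def fun_eq_iff)
      also have "h (z + 1 / z) * kern q z / z * ((1 - z\<^sup>2 / of_nat q) / (1 - of_real x * z + z\<^sup>2))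
          = h (z + 1 / z) * ((kern q z * (1 - z\<^sup>2 / of_nat q)) / (1 - of_real x * z + z\<^sup>2)) / z"
        by (simp add: mult_ac)
      finally show "h (z + 1 / z) * ((1 - z\<^sup>2) / (1 - of_real x * z + z\<^sup>2)) / z = (\<Sum>i. G i z)"
        unfolding k by (simp add: sums_iff)
    qed
    thus ?thesis by (rule contour_integral_unique)
  qed
  ultimately have "(\<lambda>n. 2 * pi * \<i> * (\<Sum>i<n. circle_coeff q \<tau> h i * of_real (X_fun i q x)))
      \<longlonglongrightarrow> 2 * pi * \<i> * h (of_real x)" by simp
  from tendsto_divide[OF this tendsto_const[of "2 * pi * \<i>"]]
  show ?thesis by (simp add: sums_def)
qed

text \<open>On the unit circle t -> 2 pi - t fixes 2 cos t and conjugates the kernel, so the two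
  half circles combine to its real part. The lower one is kept because 2 cos t increases there from
  -2 to 2.\<close>

theorem circle_coeff_eq_integral:
  assumes q: "q \<ge> 1" and \<rho>: "\<rho> > sqrt (real q)" and h: "h holomorphic_on Omega \<rho>"
    and \<tau>: "1 / \<rho> < \<tau>" "\<tau> < 1"
  shows "circle_coeff q \<tau> h r =
    integral {pi..2*pi} (\<lambda>t. h (of_real (2 * cos t)) * of_real (Re (kern q (cis t) * cis t ^ r))) / pi"
proof -
  have sq1: "sqrt (real q) \<ge> 1" using q by simp
  have \<rho>1: "\<rho> > 1" using \<rho> sq1 by linarith
  have \<tau>0: "\<tau> > 0" using \<tau> \<rho>1 by (meson less_trans zero_less_divide_1_iff zero_less_one)
  define S where "S = {z. 1 / \<rho> < norm z \<and> norm z < \<rho>} \<inter> kern_domain q"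
  define f where "f z = h (z + 1 / z) * kern q z * z ^ r / z" for z
  have holo: "f holomorphic_on S"
    unfolding f_def S_def by (rule integrand_holomorphic[OF \<rho>1 h])
  have "open {z :: complex. 1 / \<rho> < norm z \<and> norm z < \<rho>}"
    by (intro open_Collect_conj open_Collect_less continuous_intros)
  hence "open S" unfolding S_def kern_domain_def by auto
  have annulus: "z \<in> S" if "\<tau> \<le> norm z" "norm z \<le> 1" for z
    using that \<tau> \<rho>1 cball_1_subset_kern_domain[OF q] by (auto simp: S_def)
  have "homotopic_loops S (circlepath 0 \<tau>) (circlepath 0 1)"
  proof (rule homotopic_loops_linear)
    fix t :: real assume "t \<in> {0..1}"
    define e where "e = exp (2 * of_real pi * \<i> * of_real t)"
    have e: "norm e = 1" by (simp add: e_def norm_exp_eq_Re)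
    have "closed_segment (of_real \<tau> * e) e \<subseteq> S"
    proof
      fix w assume "w \<in> closed_segment (of_real \<tau> * e) e"
      then obtain u where u: "0 \<le> u" "u \<le> 1" "w = (1 - u) *\<^sub>R (of_real \<tau> * e) + u *\<^sub>R e"
        by (auto simp: in_segment)
      have "w = of_real ((1 - u) * \<tau> + u) * e" using u by (simp add: scaleR_conv_of_real algebra_simps)
      hence "norm w = \<bar>(1 - u) * \<tau> + u\<bar>" by (simp only: norm_mult e norm_of_real) simp
      moreover have "(1 - u) * \<tau> + u = \<tau> + u * (1 - \<tau>)" by (simp add: algebra_simps)
      moreover have "0 \<le> u * (1 - \<tau>)" "u * (1 - \<tau>) \<le> 1 - \<tau>" using u \<tau> by (auto intro: mult_left_le_one_le)
      ultimately show "w \<in> S" using annulus[of w] \<tau>0 by auto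
    qed
    thus "closed_segment (circlepath 0 \<tau> t) (circlepath 0 1 t) \<subseteq> S"
      by (simp add: circlepath e_def)
  qed auto
  hence "contour_integral (circlepath 0 \<tau>) f = contour_integral (circlepath 0 1) f"
    by (rule Cauchy_theorem_homotopic_loops) (use \<open>open S\<close> holo in auto)
  also have "\<dots> = integral {0..2*pi} (\<lambda>t. f (cis t) * \<i> * cis t)"
    unfolding circlepath_def by (subst contour_integral_part_circlepath_eq) auto
  also have "(\<lambda>t. f (cis t) * \<i> * cis t) = (\<lambda>t. \<i> * (h (of_real (2 * cos t)) * (kern q (cis t) * cis t ^ r)))"
  proof
    fix t
    have "1 / cis t = cis (- t)" by (simp add: cis_inverse divide_inverse)
    hence "cis t + 1 / cis t = of_real (2 * cos t)" by (simp add: complex_eq_iff)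
    thus "f (cis t) * \<i> * cis t = \<i> * (h (of_real (2 * cos t)) * (kern q (cis t) * cis t ^ r))"
      by (simp add: f_def)
  qed
  also have "integral {0..2*pi} \<dots> = \<i> * integral {0..2*pi} (\<lambda>t. h (of_real (2 * cos t)) * (kern q (cis t) * cis t ^ r))"
    by simp
  finally have int1: "contour_integral (circlepath 0 \<tau>) f
    = \<i> * integral {0..2*pi} (\<lambda>t. h (of_real (2 * cos t)) * (kern q (cis t) * cis t ^ r))" .
  define g where "g t = h (of_real (2 * cos t)) * (kern q (cis t) * cis t ^ r)" for t
  have cont: "continuous_on UNIV g"
  proof -
    have "continuous_on UNIV (h \<circ> (\<lambda>t. of_real (2 * cos t)))"
    proof (rule continuous_on_compose)
      have "complex_of_real (2 * cos t) \<in> Omega \<rho>" for t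
      proof -
        have "cis t + 1 / cis t = of_real (2 * cos t)" by (simp add: complex_eq_iff cis_inverse divide_inverse)
        moreover have "cis t + 1 / cis t \<in> Omega \<rho>" by (rule joukowski_in_Omega[OF \<rho>1]) (use \<rho>1 in auto)
        ultimately show ?thesis by simp
      qed
      thus "continuous_on (range (\<lambda>t. complex_of_real (2 * cos t))) h"
        by (intro continuous_on_subset[OF holomorphic_on_imp_continuous_on[OF h]]) auto
    qed (intro continuous_intros)
    moreover note continuous_on_kern_cis[OF q]
    ultimately show ?thesis unfolding g_def o_def by (intro continuous_intros)
  qed
  have integrable: "g integrable_on {a..b}" for a b
    by (intro integrable_continuous_interval continuous_on_subset[OF cont]) auto
  have kern_cnj: "kern q (cnj z) = cnj (kern q z)" for z by (simp add: kern_def)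
  have "(g has_integral integral {0..pi} g) (cbox 0 pi)" using integrable by (simp add: integrable_integral)
  from has_integral_affinity[OF this, of "-1" "2 * pi"]
  have "((\<lambda>t. g (2 * pi - t)) has_integral integral {0..pi} g) ((\<lambda>t. 2 * pi - t) ` {0..pi})"
    by (simp add: algebra_simps)
  also have "(\<lambda>t. 2 * pi - t) ` {0..pi} = {pi..2*pi}"
    by simp
  also have "(\<lambda>t. g (2 * pi - t)) = (\<lambda>t. h (of_real (2 * cos t)) * cnj (kern q (cis t) * cis t ^ r))"
  proof
    fix t
    have "cis (2 * pi - t) = cnj (cis t)" by (simp add: complex_eq_iff sin_diff cos_diff)
    moreover have "cos (2 * pi - t) = cos t" by (simp add: cos_diff)
    ultimately show "g (2 * pi - t) = h (of_real (2 * cos t)) * cnj (kern q (cis t) * cis t ^ r)"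
      by (simp add: g_def kern_cnj)
  qed
  finally have refl: "((\<lambda>t. h (of_real (2 * cos t)) * cnj (kern q (cis t) * cis t ^ r)) has_integral integral {0..pi} g) {pi..2*pi}" .
  have "(g has_integral integral {pi..2*pi} g) {pi..2*pi}" using integrable by (simp add: integrable_integral)
  from has_integral_add[OF refl this]
  have "((\<lambda>t. 2 * (h (of_real (2 * cos t)) * of_real (Re (kern q (cis t) * cis t ^ r)))) has_integral
     (integral {0..pi} g + integral {pi..2*pi} g)) {pi..2*pi}"
  proof (rule has_integral_eq[rotated])
    have "c * cnj w + c * w = 2 * (c * of_real (Re w))" for c w by (simp add: complex_eq_iff algebra_simps)
    thus "h (of_real (2 * cos t)) * cnj (kern q (cis t) * cis t ^ r) + g t
        = 2 * (h (of_real (2 * cos t)) * of_real (Re (kern q (cis t) * cis t ^ r)))" for t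
      unfolding g_def .
  qed
  also have "integral {0..pi} g + integral {pi..2*pi} g = integral {0..2*pi} g"
    by (rule Henstock_Kurzweil_Integration.integral_combine) (use integrable in auto)
  finally have "integral {0..2*pi} g = 2 * integral {pi..2*pi} (\<lambda>t. h (of_real (2 * cos t)) * of_real (Re (kern q (cis t) * cis t ^ r)))"
    unfolding integral_mult_right[symmetric] by (rule integral_unique[symmetric])
  thus ?thesis using int1 unfolding circle_coeff_def f_def[symmetric] g_def[symmetric]
    by (simp only:) simp
qed

section \<open>Integrals against the Kesten--McKay distribution\<close>

text \<open>This is X_r = U_r - U_(r-2)/q together with U_k(cos t) sin t = sin((k+1) t). For n = 0
  the absent U_(-1) is represented by sin 0 = 0.\<close>

lemma X_fun_cos:
  "X_fun (Suc n) q (2 * cos t) * sin t = sin (real (n + 2) * t) - sin (real n * t) / real q"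
proof (induction n rule: induct_nat_012)
  case 0
  show ?case by (simp add: X_fun_eq_poly sin_double)
next
  case 1
  have "sin (3 * t) = sin (2 * t + t)" by (simp add: algebra_simps)
  also have "\<dots> = 4 * (cos t)\<^sup>2 * sin t - sin t"
    unfolding sin_add sin_double cos_double_cos by (simp add: algebra_simps power2_eq_square)
  finally show ?case by (simp add: X_fun_eq_poly algebra_simps power2_eq_square)
next
  case (ge2 n)
  have rec: "sin (real (m + 2) * t) = 2 * cos t * sin (real (m + 1) * t) - sin (real m * t)" for m
  proof -
    have "sin (real (m + 1) * t + t) + sin (real (m + 1) * t - t) = 2 * cos t * sin (real (m + 1) * t)"
      by (simp add: sin_add sin_diff)
    thus ?thesis by (simp add: algebra_simps)
  qed
  have "X_fun (Suc (Suc (Suc n))) q (2 * cos t) * sin t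
      = 2 * cos t * (X_fun (Suc (Suc n)) q (2 * cos t) * sin t) - X_fun (Suc n) q (2 * cos t) * sin t"
    by (simp add: X_fun_eq_poly algebra_simps)
  also have "\<dots> = (2 * cos t * sin (real (n + 3) * t) - sin (real (n + 2) * t))
      - (2 * cos t * sin (real (n + 1) * t) - sin (real n * t)) / real q"
    unfolding ge2 by (simp add: algebra_simps diff_divide_distrib)
  also have "\<dots> = sin (real (n + 4) * t) - sin (real (n + 2) * t) / real q"
  proof -
    have r1: "2 * cos t * sin (real (n + 1) * t) - sin (real n * t) = sin (real (n + 2) * t)"
      by (rule rec[symmetric])
    have r2: "2 * cos t * sin (real (n + 3) * t) - sin (real (n + 2) * t) = sin (real (n + 4) * t)"
      using rec[of "n + 2"] by (simp only: add.assoc) simp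
    show ?thesis unfolding r1 r2 ..
  qed
  finally show ?case by (simp add: algebra_simps)
qed

text \<open>Expanding by the conjugate of the denominator produces |1 - p e^(2it)|^2, which up to
  the factor q is the Kesten-McKay denominator at 2 cos t.\<close>

lemma Re_kern_cis_power:
  assumes q: "q > 1"
  defines "p \<equiv> 1 / real q"
  shows "Re (kern q (cis t) * cis t ^ r) =
    ((1 + p) * cos (real r * t) - cos ((real r + 2) * t) - p * cos ((real r - 2) * t)) /
      (1 + p\<^sup>2 - 2 * p * cos (2 * t))"
proof -
  have z2: "(cis t)\<^sup>2 = cis (2 * t)" by (simp add: Complex.DeMoivre)
  define d where "d = 1 - of_real p * cis (2 * t)"
  have "(cmod d)\<^sup>2 = (1 - p * cos (2 * t))\<^sup>2 + (p * sin (2 * t))\<^sup>2"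
    by (simp add: d_def cmod_power2)
  moreover have "(1 - p * c)\<^sup>2 + (p * s)\<^sup>2 = 1 + p\<^sup>2 * (c\<^sup>2 + s\<^sup>2) - 2 * p * c" for c s :: real
    by (simp add: power2_eq_square algebra_simps)
  ultimately have d: "(cmod d)\<^sup>2 = 1 + p\<^sup>2 - 2 * p * cos (2 * t)" by simp
  have "kern q (cis t) * cis t ^ r = (1 - cis (2 * t)) * cis (real r * t) / d"
    using q by (simp add: kern_def z2 d_def p_def Complex.DeMoivre)
  also have "\<dots> = (1 - cis (2 * t)) * cis (real r * t) * cnj d / of_real ((cmod d)\<^sup>2)"
    by (subst complex_div_cnj) simp
  also have "(1 - cis (2 * t)) * cis (real r * t) * cnj d =
     of_real (1 + p) * cis (real r * t) - cis ((real r + 2) * t) - of_real p * cis ((real r - 2) * t)"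
  proof -
    have "cis (2 * t) * cis (real r * t) = cis ((real r + 2) * t)"
      by (simp add: cis_mult algebra_simps)
    moreover have "cis (real r * t) * cnj (cis (2 * t)) = cis ((real r - 2) * t)"
      by (simp add: cis_cnj cis_mult algebra_simps)
    moreover have "cis (2 * t) * cnj (cis (2 * t)) = 1" by (simp add: cis_cnj cis_mult)
    moreover have "(1 - A) * B * (1 - P * C) = (1 + P * (A * C)) * B - A * B - P * (B * C)" for A B C P :: complex
      by (simp add: algebra_simps)
    ultimately show ?thesis by (simp add: d_def)
  qed
  finally show ?thesis by (simp add: d)
qed

text \<open>For pi < t < 2 pi both the Jacobian and the root in the density equal -2 sin t; they
  cancel for q = 1 and give 4 (sin t)^2 for q > 1. The factor 1 + 1/q for r \<ge> 1 is the one
  inverted in \<open>a_coeff\<close>.\<close>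

lemma kesten_mckay_density_cos:
  assumes q: "q \<ge> 1" and t: "pi < t" "t < 2 * pi"
  shows "kesten_mckay_density q (2 * cos t) * (- 2 * sin t) * X_fun r q (2 * cos t) =
    (if r = 0 then 1 else 1 + 1 / real q) / pi * Re (kern q (cis t) * cis t ^ r)"
proof -
  have sin: "sin t < 0" using t by (rule sin_lt_zero)
  have "4 - (2 * cos t)\<^sup>2 = (2 * sin t)\<^sup>2" by (simp add: power_mult_distrib cos_squared_eq)
  hence "sqrt (4 - (2 * cos t)\<^sup>2) = \<bar>2 * sin t\<bar>" by (simp only: real_sqrt_abs)
  hence root: "sqrt (4 - (2 * cos t)\<^sup>2) = - 2 * sin t" using sin by simp
  have c2: "\<bar>2 * cos t\<bar> \<le> 2" by (simp add: abs_mult)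
  show ?thesis
  proof (cases "q = 1")
    case True
    have dens: "kesten_mckay_density q (2 * cos t) * (- 2 * sin t) = 1 / pi"
      using sin c2 root True by (simp add: kesten_mckay_density_def)
    show ?thesis
    proof (cases r)
      case 0
      show ?thesis unfolding dens using 0 True by (simp add: X_fun_eq_poly kern_def)
    next
      case (Suc n)
      have "real (n + 2) * t = real r * t + t" "real n * t = real r * t - t"
        using Suc by (simp_all add: algebra_simps)
      hence "X_fun r q (2 * cos t) * sin t = 2 * cos (real r * t) * sin t"
        using X_fun_cos[of n q t] Suc True by (simp add: sin_add sin_diff)
      hence "X_fun r q (2 * cos t) = 2 * cos (real r * t)" using sin by simp
      moreover have "Re (kern q (cis t) * cis t ^ r) = cos (real r * t)"
        by (simp add: True kern_def Complex.DeMoivre)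
      ultimately show ?thesis unfolding dens using Suc True by simp
    qed
  next
    case False
    hence q1: "q > 1" using q by simp
    define p where "p = 1 / real q"
    define E where "E = 1 + p\<^sup>2 - 2 * p * cos (2 * t)"
    have p: "0 < p" "p < 1" using q1 by (simp_all add: p_def)
    have "0 < (1 - p)\<^sup>2" using p by simp
    also have "(1 - p)\<^sup>2 = 1 + p\<^sup>2 - 2 * p * 1" by (simp add: power2_eq_square algebra_simps)
    also have "\<dots> \<le> E" unfolding E_def using p by (intro diff_left_mono mult_left_mono) auto
    finally have E: "E > 0" .
    have "p * ((sqrt (real q) + 1 / sqrt (real q))\<^sup>2 - (2 * cos t)\<^sup>2)
        = p * (real q + 2 + p - 4 * (cos t)\<^sup>2)"
      using q1 by (simp add: power2_sum power_divide p_def power_mult_distrib)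
    also have "\<dots> = E"
      unfolding E_def cos_double_cos using q1 by (simp add: p_def power2_eq_square field_simps)
    finally have D: "(sqrt (real q) + 1 / sqrt (real q))\<^sup>2 - (2 * cos t)\<^sup>2 = real q * E"
      using q1 by (simp add: p_def field_simps)
    have "kesten_mckay_density q (2 * cos t) * (- 2 * sin t) = 1 / (2 * pi) * ((real q + 1) * (- 2 * sin t) / (real q * E)) * (- 2 * sin t)"
      unfolding kesten_mckay_density_def if_P[OF c2] if_not_P[OF False] root D ..
    also have "\<dots> = (1 + p) / pi * (2 * sin t * sin t) / E"
      using q1 E by (simp add: p_def field_simps)
    finally have dens: "kesten_mckay_density q (2 * cos t) * (- 2 * sin t) = (1 + p) / pi * (2 * sin t * sin t) / E" .
    show ?thesis
    proof (cases r)
      case 0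
      have "(1 + p) * (2 * sin t * sin t) = (1 + p) - cos (2 * t) - p * cos (2 * t)"
        unfolding cos_double_sin by (simp add: algebra_simps power2_eq_square)
      hence "Re (kern q (cis t) * cis t ^ r) = (1 + p) * (2 * sin t * sin t) / E"
        unfolding Re_kern_cis_power[OF q1] p_def[symmetric] E_def[symmetric] using 0 by simp
      thus ?thesis unfolding dens using 0 by (simp add: X_fun_eq_poly)
    next
      case (Suc n)
      have 1: "2 * sin t * sin (real (n + 2) * t) = cos (real r * t) - cos ((real r + 2) * t)"
      proof -
        have "real r * t = real (n + 2) * t - t" "(real r + 2) * t = real (n + 2) * t + t"
          using Suc by (simp_all add: algebra_simps)
        thus ?thesis by (simp only: cos_add cos_diff) simp
      qed
      have 2: "2 * sin t * sin (real n * t) = cos ((real r - 2) * t) - cos (real r * t)"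
      proof -
        have "real r * t = real n * t + t" "(real r - 2) * t = real n * t - t"
          using Suc by (simp_all add: algebra_simps)
        thus ?thesis by (simp only: cos_add cos_diff) simp
      qed
      have "2 * sin t * sin t * X_fun r q (2 * cos t) = 2 * sin t * (X_fun (Suc n) q (2 * cos t) * sin t)"
        using Suc by simp
      also have "\<dots> = 2 * sin t * sin (real (n + 2) * t) - p * (2 * sin t * sin (real n * t))"
        unfolding X_fun_cos p_def by (simp add: algebra_simps)
      also have "\<dots> = (1 + p) * cos (real r * t) - cos ((real r + 2) * t) - p * cos ((real r - 2) * t)"
        unfolding 1 2 by (simp add: algebra_simps)
      also have "\<dots> = E * Re (kern q (cis t) * cis t ^ r)"
        unfolding Re_kern_cis_power[OF q1] p_def[symmetric] E_def[symmetric] using E by simp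
      finally have eq: "2 * sin t * sin t * X_fun r q (2 * cos t) = E * Re (kern q (cis t) * cis t ^ r)" .
      have "(1 + p) / pi * (2 * sin t * sin t) / E * X_fun r q (2 * cos t)
          = (1 + p) / pi * (2 * sin t * sin t * X_fun r q (2 * cos t)) / E" by simp
      also have "\<dots> = (1 + p) / pi * Re (kern q (cis t) * cis t ^ r)"
        unfolding eq using E by (simp del: times_complex.sel)
      finally show ?thesis unfolding dens using Suc by (simp add: p_def del: times_complex.sel)
    qed
  qed
qed

section \<open>Integrability of the density and the substitution x = 2 cos t\<close>

lemma four_le_square: "q \<ge> 1 \<Longrightarrow> 4 \<le> (sqrt (real q) + 1 / sqrt (real q))\<^sup>2"
proof -
  assume q: "q \<ge> 1"
  have "0 \<le> (sqrt (real q) - 1 / sqrt (real q))\<^sup>2" by simp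
  thus ?thesis using q by (simp add: power2_sum power2_diff)
qed

lemma kesten_mckay_density_nonneg:
  assumes "q \<ge> 1" shows "kesten_mckay_density q x \<ge> 0"
proof -
  have "x\<^sup>2 \<le> 4" if "\<bar>x\<bar> \<le> 2" using abs_le_square_iff[of x 2] that by simp
  hence "0 \<le> (sqrt (real q) + 1 / sqrt (real q))\<^sup>2 - x\<^sup>2" "0 \<le> sqrt (4 - x\<^sup>2)" if "\<bar>x\<bar> \<le> 2"
    using four_le_square[OF assms] that by (force, simp)
  thus ?thesis unfolding kesten_mckay_density_def
    by (auto intro!: mult_nonneg_nonneg divide_nonneg_nonneg)
qed

lemma kesten_mckay_density_measurable [measurable]: "kesten_mckay_density q \<in> borel_measurable borel"
  unfolding kesten_mckay_density_def[abs_def] by measurable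

lemma isCont_kesten_mckay_density:
  assumes q: "q \<ge> 1" and x: "-2 < x" "x < 2"
  shows "isCont (kesten_mckay_density q) x"
proof -
  have sq: "y\<^sup>2 < 4" if "y \<in> {-2<..<2}" for y :: real
    using abs_square_less_1[of "y / 2"] that by (auto simp: power_divide)
  have "continuous_on {-2<..<2} (kesten_mckay_density q)"
  proof (cases "q = 1")
    case True
    have "continuous_on {-2<..<2} (\<lambda>x. 1 / (pi * sqrt (4 - x\<^sup>2)))"
      by (intro continuous_intros) (use sq in force)
    thus ?thesis by (rule continuous_on_eq) (use True in \<open>auto simp: kesten_mckay_density_def\<close>)
  next
    case False
    have "continuous_on {-2<..<2} (\<lambda>x. 1 / (2 * pi) * ((real q + 1) * sqrt (4 - x\<^sup>2) /
               ((sqrt (real q) + 1 / sqrt (real q))\<^sup>2 - x\<^sup>2)))"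
      by (intro continuous_intros) (use sq four_le_square[OF q] in force)
    thus ?thesis by (rule continuous_on_eq) (use False in \<open>auto simp: kesten_mckay_density_def\<close>)
  qed
  thus ?thesis using x by (simp add: continuous_on_eq_continuous_at)
qed

lemma sin_nonpos:
  assumes "pi \<le> t" "t \<le> 2 * pi" shows "sin t \<le> 0"
  using sin_ge_zero[of "t - pi"] assms by (simp add: sin_diff)

lemma tendsto_two_cos:
  "((ereal \<circ> (\<lambda>t. 2 * cos t) \<circ> real_of_ereal) \<longlongrightarrow> ereal (-2)) (at_right (ereal pi))"
  "((ereal \<circ> (\<lambda>t. 2 * cos t) \<circ> real_of_ereal) \<longlongrightarrow> ereal 2) (at_left (ereal (2 * pi)))"
proof -
  have "((\<lambda>t. ereal (2 * cos t)) \<longlongrightarrow> ereal (2 * cos pi)) (at_right pi)"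
    "((\<lambda>t. ereal (2 * cos t)) \<longlongrightarrow> ereal (2 * cos (2 * pi))) (at_left (2 * pi))"
    by (intro tendsto_intros)+
  thus "((ereal \<circ> (\<lambda>t. 2 * cos t) \<circ> real_of_ereal) \<longlongrightarrow> ereal (-2)) (at_right (ereal pi))"
    "((ereal \<circ> (\<lambda>t. 2 * cos t) \<circ> real_of_ereal) \<longlongrightarrow> ereal 2) (at_left (ereal (2 * pi)))"
    unfolding ereal_tendsto_simps by (simp_all add: o_def)
qed

lemma two_cos_between:
  assumes "pi < t" "t < 2 * pi" shows "-2 < 2 * cos t" "2 * cos t < 2"
proof -
  have "(sin t)\<^sup>2 > 0" using sin_lt_zero[OF assms] by simp
  hence "(cos t)\<^sup>2 < 1" by (simp add: cos_squared_eq)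
  hence "\<bar>cos t\<bar> < 1" by (simp only: abs_square_less_1)
  thus "-2 < 2 * cos t" "2 * cos t < 2" by auto
qed

text \<open>For q = 1 the density is unbounded near 2 and -2. In the variable t it becomes the
  continuous function Re (kern q (cis t)) / pi, and nonnegativity transfers integrability
  back.\<close>

lemma integrable_kesten_mckay_density:
  assumes q: "q \<ge> 1" shows "integrable lborel (kesten_mckay_density q)"
proof -
  have "set_integrable lborel {pi..2*pi} (\<lambda>t. 1 / pi * Re (kern q (cis t)))"
    by (intro borel_integrable_atLeastAtMost' continuous_intros continuous_on_subset[OF continuous_on_kern_cis[OF q]]) auto
  hence "set_integrable lborel {pi<..<2*pi} (\<lambda>t. 1 / pi * Re (kern q (cis t)))"
    by (rule set_integrable_subset) auto
  also have "?this \<longleftrightarrow> set_integrable lborel (einterval (ereal pi) (ereal (2*pi)))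
     (\<lambda>t. kesten_mckay_density q (2 * cos t) * (- 2 * sin t))"
    unfolding einterval_eq using kesten_mckay_density_cos[OF q, of _ 0]
    by (intro set_integrable_cong refl) (simp add: X_fun_eq_poly)
  finally have int: "set_integrable lborel (einterval (ereal pi) (ereal (2*pi)))
     (\<lambda>t. kesten_mckay_density q (2 * cos t) * (- 2 * sin t))" .
  have "set_integrable lborel (einterval (ereal (-2)) (ereal 2)) (kesten_mckay_density q)"
  proof (rule interval_integral_substitution_nonneg(1)[OF _ _ _ _ _ _ tendsto_two_cos int])
    show "isCont (kesten_mckay_density q) (2 * cos t)" if "ereal pi < ereal t" "ereal t < ereal (2 * pi)" for t
      using two_cos_between[of t] that by (intro isCont_kesten_mckay_density[OF q]) auto
    show "0 \<le> - 2 * sin t" if "ereal pi \<le> ereal t" "ereal t \<le> ereal (2 * pi)" for t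
      using sin_nonpos[of t] that by simp
    show "((\<lambda>t. 2 * cos t) has_real_derivative - 2 * sin t) (at t)" for t
      by (auto intro!: derivative_eq_intros)
  qed (auto intro: kesten_mckay_density_nonneg[OF q])
  hence "integrable lborel (\<lambda>x. indicator {-2<..<2} x *\<^sub>R kesten_mckay_density q x)"
    by (simp add: set_integrable_def einterval_eq)
  moreover have "AE x in lborel. indicator {-2<..<2} x *\<^sub>R kesten_mckay_density q x = kesten_mckay_density q x"
    using AE_lborel_singleton[of "-2"] AE_lborel_singleton[of 2]
    by eventually_elim (auto simp: kesten_mckay_density_def indicator_def)
  ultimately show ?thesis by (subst (asm) integrable_cong_AE) auto
qed

theorem kesten_mckay_integral:
  fixes \<phi> :: "real \<Rightarrow> complex"
  assumes q: "q \<ge> 1" and \<phi>: "continuous_on {-2..2} \<phi>"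
  shows "set_integrable (kesten_mckay q) {-2..2} \<phi>"
    and "(LINT x:{-2..2}|kesten_mckay q. \<phi> x) =
           (LBINT t=pi..2*pi. (kesten_mckay_density q (2 * cos t) * (- 2 * sin t)) *\<^sub>R \<phi> (2 * cos t))"
proof -
  let ?d = "kesten_mckay_density q"
  have meas: "(\<lambda>x. indicator {-2..2} x *\<^sub>R \<phi> x) \<in> borel_measurable borel"
    by (rule borel_measurable_continuous_on_indicator[OF _ \<phi>]) simp
  obtain B where B: "\<And>x. x \<in> {-2..2} \<Longrightarrow> norm (\<phi> x) \<le> B"
    using compact_imp_bounded[OF compact_continuous_image[OF \<phi> compact_Icc]]
    unfolding bounded_iff by blast
  have "integrable lborel (\<lambda>x. ?d x *\<^sub>R (indicator {-2..2} x *\<^sub>R \<phi> x))"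
  proof (rule Bochner_Integration.integrable_bound)
    show "integrable lborel (\<lambda>x. B * ?d x)"
      using integrable_kesten_mckay_density[OF q] by simp
    show "(\<lambda>x. ?d x *\<^sub>R (indicator {-2..2} x *\<^sub>R \<phi> x)) \<in> borel_measurable lborel"
      using borel_measurable_scaleR[OF kesten_mckay_density_measurable meas] by simp
    have "norm (\<phi> 0) \<le> B" by (rule B) simp
    hence "B \<ge> 0" by (rule order_trans[OF norm_ge_zero])
    have "norm (?d x *\<^sub>R (indicator {-2..2} x *\<^sub>R \<phi> x)) \<le> norm (B * ?d x)" for x
    proof (cases "x \<in> {-2..2}")
      case True
      thus ?thesis using mult_left_mono[OF B[OF True] kesten_mckay_density_nonneg[OF q, of x]]
          kesten_mckay_density_nonneg[OF q, of x] \<open>B \<ge> 0\<close> by (simp add: abs_mult mult.commute)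
    qed simp
    thus "AE x in lborel. norm (?d x *\<^sub>R (indicator {-2..2} x *\<^sub>R \<phi> x)) \<le> norm (B * ?d x)" by simp
  qed
  hence int: "integrable lborel (\<lambda>x. indicator {-2..2} x *\<^sub>R (?d x *\<^sub>R \<phi> x))"
    by (simp add: mult.commute)
  thus "set_integrable (kesten_mckay q) {-2..2} \<phi>"
    unfolding set_integrable_def kesten_mckay_def using meas kesten_mckay_density_nonneg[OF q]
    by (subst integrable_density) (auto simp: mult.commute)
  have "(LINT x:{-2..2}|kesten_mckay q. \<phi> x) = (LINT x:{-2..2}|lborel. ?d x *\<^sub>R \<phi> x)"
    unfolding set_lebesgue_integral_def kesten_mckay_def using meas kesten_mckay_density_nonneg[OF q]
    by (subst integral_density) (auto simp: mult.commute)
  also have "\<dots> = (LBINT x=-2..2. ?d x *\<^sub>R \<phi> x)"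
    by (subst interval_integral_Icc[of "-2" 2, symmetric]) auto
  also have "\<dots> = (LBINT t=ereal pi..ereal (2*pi). (- 2 * sin t) *\<^sub>R (?d (2 * cos t) *\<^sub>R \<phi> (2 * cos t)))"
  proof (rule interval_integral_substitution_integrable)
    show "isCont (\<lambda>x. ?d x *\<^sub>R \<phi> x) (2 * cos t)" if "ereal pi < ereal t" "ereal t < ereal (2 * pi)" for t
    proof -
      have "2 * cos t \<in> interior {-2..2}" using two_cos_between[of t] that by simp
      hence "isCont \<phi> (2 * cos t)" using \<phi> by (rule continuous_on_interior[rotated])
      thus ?thesis using two_cos_between[of t] that
        by (intro continuous_intros isCont_kesten_mckay_density[OF q]) auto
    qed
    have "set_integrable lborel {-2..2} (\<lambda>x. ?d x *\<^sub>R \<phi> x)" using int by (simp add: set_integrable_def)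
    thus "set_integrable lborel (einterval (-2) 2) (\<lambda>x. ?d x *\<^sub>R \<phi> x)"
      by (rule set_integrable_subset) (auto simp: einterval_def)
    \<comment> \<open>By the case r = 0 of \<open>kesten_mckay_density_cos\<close>, the transformed
      integrand agrees on the open interval with this function, continuous up to the
      endpoints.\<close>
    have "continuous_on {pi..2*pi} (\<lambda>t. (1 / pi * Re (kern q (cis t))) *\<^sub>R \<phi> (2 * cos t))"
      by (intro continuous_intros continuous_on_subset[OF continuous_on_kern_cis[OF q]] continuous_on_compose2[OF \<phi>]) auto
    hence "set_integrable lborel {pi..2*pi} (\<lambda>t. (1 / pi * Re (kern q (cis t))) *\<^sub>R \<phi> (2 * cos t))"
      by (rule borel_integrable_atLeastAtMost')
    hence "set_integrable lborel {pi<..<2*pi} (\<lambda>t. (1 / pi * Re (kern q (cis t))) *\<^sub>R \<phi> (2 * cos t))"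
      by (rule set_integrable_subset) auto
    also have "?this \<longleftrightarrow> set_integrable lborel (einterval (ereal pi) (ereal (2 * pi)))
        (\<lambda>t. (- 2 * sin t) *\<^sub>R (?d (2 * cos t) *\<^sub>R \<phi> (2 * cos t)))"
      unfolding einterval_eq scaleR_scaleR using kesten_mckay_density_cos[OF q, of _ 0]
      by (intro set_integrable_cong refl arg_cong2[of _ _ _ _ scaleR]) (simp add: X_fun_eq_poly mult.commute)
    finally show "set_integrable lborel (einterval (ereal pi) (ereal (2 * pi)))
        (\<lambda>t. (- 2 * sin t) *\<^sub>R (?d (2 * cos t) *\<^sub>R \<phi> (2 * cos t)))" .
    show "0 \<le> - 2 * sin t" if "ereal pi \<le> ereal t" "ereal t \<le> ereal (2 * pi)" for t
      using sin_nonpos[of t] that by simp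
    show "((\<lambda>t. 2 * cos t) has_real_derivative - 2 * sin t) (at t)" for t
      by (auto intro!: derivative_eq_intros)
  qed (use tendsto_two_cos in auto)
  finally show "(LINT x:{-2..2}|kesten_mckay q. \<phi> x) =
     (LBINT t=pi..2*pi. (?d (2 * cos t) * (- 2 * sin t)) *\<^sub>R \<phi> (2 * cos t))"
    by (simp add: mult.commute)
qed

theorem kesten_mckay_integral_X_fun:
  fixes h :: "complex \<Rightarrow> complex"
  assumes q: "q \<ge> 1" and h: "continuous_on {-2..2} (\<lambda>x. h (complex_of_real x))"
  shows "(LINT x:{-2..2}|kesten_mckay q. h (of_real x) * of_real (X_fun r q x)) =
    of_real (if r = 0 then 1 else 1 + 1 / real q) *
    (integral {pi..2*pi} (\<lambda>t. h (of_real (2 * cos t)) * of_real (Re (kern q (cis t) * cis t ^ r))) / pi)"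
proof -
  let ?c = "if r = 0 then 1 else 1 + 1 / real q"
  have "continuous_on {-2..2} (\<lambda>x. h (of_real x) * complex_of_real (X_fun r q x))"
    unfolding X_fun_eq_poly by (intro continuous_intros h)
  from kesten_mckay_integral(2)[OF q this]
  have "(LINT x:{-2..2}|kesten_mckay q. h (of_real x) * of_real (X_fun r q x)) =
     (LBINT t=pi..2*pi. (kesten_mckay_density q (2 * cos t) * (- 2 * sin t)) *\<^sub>R (h (of_real (2 * cos t)) * complex_of_real (X_fun r q (2 * cos t))))" .
  also have "\<dots> = (LBINT t=pi..2*pi. of_real (?c / pi) * (h (of_real (2 * cos t)) * of_real (Re (kern q (cis t) * cis t ^ r))))"
  proof (rule interval_integral_cong)
    fix t assume "t \<in> einterval (min (ereal pi) (ereal (2 * pi))) (max (ereal pi) (ereal (2 * pi)))"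
    hence t: "pi < t" "t < 2 * pi" by (auto simp: einterval_def min_def max_def split: if_splits)
    have "(kesten_mckay_density q (2 * cos t) * (- 2 * sin t)) *\<^sub>R (h (of_real (2 * cos t)) * complex_of_real (X_fun r q (2 * cos t)))
       = of_real (kesten_mckay_density q (2 * cos t) * (- 2 * sin t) * X_fun r q (2 * cos t)) * h (of_real (2 * cos t))"
      by (simp add: scaleR_conv_of_real)
    also have "\<dots> = of_real (?c / pi) * (h (of_real (2 * cos t)) * of_real (Re (kern q (cis t) * cis t ^ r)))"
      unfolding kesten_mckay_density_cos[OF q t] of_real_mult by (simp only: mult_ac)
    finally show "(kesten_mckay_density q (2 * cos t) * (- 2 * sin t)) *\<^sub>R (h (of_real (2 * cos t)) * complex_of_real (X_fun r q (2 * cos t)))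
       = of_real (?c / pi) * (h (of_real (2 * cos t)) * of_real (Re (kern q (cis t) * cis t ^ r)))" .
  qed
  also have "\<dots> = integral {pi..2*pi} (\<lambda>t. of_real (?c / pi) * (h (of_real (2 * cos t)) * of_real (Re (kern q (cis t) * cis t ^ r))))"
    by (intro interval_integral_eq_integral borel_integrable_atLeastAtMost' continuous_intros
        continuous_on_subset[OF continuous_on_kern_cis[OF q]] continuous_on_compose2[OF h]) auto
  finally show ?thesis unfolding integral_mult_right by (simp only: of_real_divide times_divide_eq_left times_divide_eq_right)
qed

section \<open>The trace formula\<close>

theorem theorem5p1:
  fixes q :: nat and G :: "('v, 'e) pre_digraph" and arev :: "'e \<Rightarrow> 'e"
    and \<rho> :: real and h :: "complex \<Rightarrow> complex" and v :: 'v
  assumes "q \<ge> 1"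
    and "regular_graph G arev (q + 1)"
    and "\<rho> > sqrt (real q)"
    and "h holomorphic_on Omega \<rho>"
    and "v \<in> verts G"
  shows "(AE x in spectral_measure q G v. x \<in> Omega_real \<rho>)
    \<and> (AE x in kesten_mckay q. x \<in> Omega_real \<rho>)
    \<and> set_integrable (spectral_measure q G v) (Omega_real \<rho>) (\<lambda>x. h (of_real x))
    \<and> set_integrable (kesten_mckay q) (Omega_real \<rho>) (\<lambda>x. h (of_real x))
    \<and> summable (\<lambda>n. of_real (real q powr (- real (Suc n) / 2)) * a_coeff (Suc n) q h
                      * of_nat (num_closed_nb_walks G arev (Suc n) v))
    \<and> (LINT x:Omega_real \<rho>|spectral_measure q G v. h (of_real x)) =
        (LINT x:Omega_real \<rho>|kesten_mckay q. h (of_real x))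
        + (\<Sum>n. of_real (real q powr (- real (Suc n) / 2)) * a_coeff (Suc n) q h
                 * of_nat (num_closed_nb_walks G arev (Suc n) v))"
proof -
  note q = assms(1) and \<rho> = assms(3) and h = assms(4)
  interpret B: bidirected_digraph G arev using assms(2) by (simp add: regular_graph_def)
  interpret rooted_regular_graph G arev q v
    by unfold_locales (use assms in \<open>auto simp: regular_graph_def out_degree_def\<close>)
  define s where "s = sqrt (real q)"
  define M where "M = spectral_measure q G v"
  define N where "N = kesten_mckay q"
  have s: "s \<ge> 1" "s < \<rho>" using q \<rho> by (simp_all add: s_def)
  hence \<rho>1: "\<rho> > 1" by simp
  \<comment> \<open>The lower bound on \<tau> keeps z + 1/z in the domain of h, the upper one makes
    the series converge on [-R, R].\<close>
  have "1 / \<rho> < 1 / s" using s by (intro divide_strict_left_mono) auto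
  then obtain \<tau> where \<tau>: "1 / \<rho> < \<tau>" "\<tau> < 1 / s" using dense by blast
  have "1 / s \<le> 1" using s by simp
  hence \<tau>1: "\<tau> < 1" using \<tau> by linarith
  have \<tau>0: "\<tau> > 0" using \<tau> \<rho>1 by (meson less_trans zero_less_divide_1_iff zero_less_one)
  have "real q = s * s" by (simp add: s_def)
  hence R: "R = s + 1 / s" using s by (simp add: R_def s_def[symmetric] field_simps)
  have "0 \<le> (s - 1)\<^sup>2" by simp
  hence R2: "2 \<le> R" using s by (simp add: R field_simps power2_eq_square)

  interpret M: real_distribution M unfolding M_def by (rule spectral_measure_props)
  have M_supp: "AE x in M. \<bar>x\<bar> \<le> R" unfolding M_def by (rule spectral_measure_props)
  have M_poly: "integrable M (\<lambda>x. poly P x)" "(\<integral>x. poly P x \<partial>M) = L P" for P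
    unfolding M_def by (rule spectral_measure_props)+
  have N_supp: "AE x in N. \<bar>x\<bar> \<le> 2"
    unfolding N_def kesten_mckay_def by (subst AE_density) (auto simp: kesten_mckay_density_def)

  have Omega_real: "x \<in> Omega_real \<rho>" if "\<bar>x\<bar> \<le> R" for x
    using of_real_in_Omega[OF s, of x] that by (simp add: Omega_real_def R)
  have "open (Omega_real \<rho>)"
    using open_vimage[OF open_Omega[OF \<rho>1], of complex_of_real]
    by (simp add: Omega_real_def vimage_def continuous_on_of_real)
  hence borel: "Omega_real \<rho> \<in> sets borel" by simp
  have h_cont: "continuous_on (Omega_real \<rho>) (\<lambda>x. h (of_real x))"
    by (rule continuous_on_compose2[OF holomorphic_on_imp_continuous_on[OF h]])
       (auto simp: Omega_real_def intro!: continuous_intros)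
  have h_meas: "(\<lambda>x. indicator (Omega_real \<rho>) x *\<^sub>R h (of_real x)) \<in> borel_measurable borel"
    by (rule borel_measurable_continuous_on_indicator[OF borel h_cont])
  have h_cont2: "continuous_on {-2..2} (\<lambda>x. h (of_real x))"
    by (rule continuous_on_subset[OF h_cont]) (use R2 in \<open>auto intro!: Omega_real\<close>)

  have goal1: "AE x in M. x \<in> Omega_real \<rho>" using M_supp by eventually_elim (rule Omega_real)
  have goal2: "AE x in N. x \<in> Omega_real \<rho>"
    using N_supp by eventually_elim (use R2 in \<open>auto intro!: Omega_real\<close>)
  have goal3: "set_integrable M (Omega_real \<rho>) (\<lambda>x. h (of_real x))"
  proof -
    have "bounded ((\<lambda>x. h (of_real x)) ` {-R..R})"
      by (intro compact_imp_bounded compact_continuous_image continuous_on_subset[OF h_cont])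
         (auto intro!: Omega_real)
    then obtain B where B: "\<forall>y\<in>(\<lambda>x. h (of_real x)) ` {-R..R}. norm y \<le> B" unfolding bounded_iff by blast
    show ?thesis unfolding set_integrable_def
    proof (rule M.integrable_const_bound[of _ B])
      show "AE x in M. norm (indicator (Omega_real \<rho>) x *\<^sub>R h (of_real x)) \<le> B"
        using M_supp
      proof eventually_elim
        case (elim x)
        hence "x \<in> {-R..R}" by auto
        hence "norm (h (of_real x)) \<le> B" using B by blast
        thus ?case using Omega_real[OF elim] by simp
      qed
    qed (use h_meas in simp)
  qed
  have h_AE: "AE x in N. indicator {-2..2} x *\<^sub>R h (of_real x) = indicator (Omega_real \<rho>) x *\<^sub>R h (of_real x)"
    using N_supp by eventually_elim (use R2 in \<open>auto simp: indicator_def abs_le_iff intro!: Omega_real\<close>)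
  have sets_N: "sets N = sets borel" by (simp add: N_def kesten_mckay_def)
  have h_meas2: "(\<lambda>x. indicator {-2..2} x *\<^sub>R h (of_real x)) \<in> borel_measurable borel"
    by (rule borel_measurable_continuous_on_indicator[OF _ h_cont2]) simp
  have N_meas: "(\<lambda>x. indicator (Omega_real \<rho>) x *\<^sub>R h (of_real x)) \<in> borel_measurable N"
    "(\<lambda>x. indicator {-2..2} x *\<^sub>R h (of_real x)) \<in> borel_measurable N"
    using h_meas h_meas2 by (simp_all add: measurable_cong_sets[OF sets_N refl])
  have goal4: "set_integrable N (Omega_real \<rho>) (\<lambda>x. h (of_real x))"
    using kesten_mckay_integral(1)[OF q h_cont2] integrable_cong_AE[OF N_meas(2,1) h_AE]
    by (simp add: set_integrable_def N_def)
  have N_int: "(LINT x:Omega_real \<rho>|N. h (of_real x)) = (LINT x:{-2..2}|N. h (of_real x))"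
    unfolding set_lebesgue_integral_def by (rule integral_cong_AE[OF N_meas]) (use h_AE in auto)

  define c where "c = circle_coeff q \<tau> h"
  have c_eq: "(LINT x:{-2..2}|N. h (of_real x) * of_real (X_fun r q x)) = of_real (if r = 0 then 1 else 1 + 1 / real q) * c r" for r
    unfolding c_def N_def circle_coeff_eq_integral[OF q \<rho> h \<tau>(1) \<tau>1]
    by (rule kesten_mckay_integral_X_fun[OF q h_cont2])
  \<comment> \<open>Since X_0 = 1, the term r = 0 of the expansion supplies the Kesten-McKay
    integral of h itself.\<close>
  have c_0: "c 0 = (LINT x:Omega_real \<rho>|N. h (of_real x))"
    using c_eq[of 0] by (simp add: N_int X_fun_eq_poly)
  have c_Suc: "a_coeff (Suc n) q h = c (Suc n)" for n
  proof -
    have "1 + 1 / real q \<noteq> 0" using q by (simp add: add_nonneg_eq_0_iff)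
    hence "inverse (1 + 1 / real q) * (1 + 1 / real q) = 1" by simp
    hence "complex_of_real (inverse (1 + 1 / real q)) * (of_real (1 + 1 / real q) * c (Suc n)) = c (Suc n)"
      by (metis mult.assoc mult_1 of_real_1 of_real_mult)
    thus ?thesis unfolding a_coeff_def using c_eq[of "Suc n"] by (simp only: N_def) simp
  qed
  obtain C where C: "C \<ge> 0" "\<forall>r. norm (c r) \<le> C * \<tau> * \<tau> ^ r"
    using circle_coeff_bound[OF q \<rho>1 h \<tau>(1) \<tau>1] unfolding c_def by blast

  \<comment> \<open>Truncation makes the bound \<open>K r\<close> valid at every point, whereas the
    estimate for X_r holds only on [-R, R].\<close>
  define f where "f r x = indicator {-R..R} x *\<^sub>R (c r * of_real (X_fun r q x))" for r x
  define K where "K r = 2 * C * \<tau> * (real (Suc r) * (s * \<tau>) ^ r)" for r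
  have "s * \<tau> < 1" using \<tau> s by (simp add: field_simps)
  hence K_summable: "summable K"
    unfolding K_def using s \<tau>0 by (intro summable_mult summable_majorant) auto
  have f_le: "norm (f r x) \<le> K r" for r x
  proof (cases "x \<in> {-R..R}")
    case True
    hence "\<bar>X_fun r q x\<bar> \<le> 2 * real (Suc r) * s ^ r"
      using X_fun_bound[OF q, of x r] unfolding s_def[symmetric] R by auto
    hence "norm (c r) * \<bar>X_fun r q x\<bar> \<le> (C * \<tau> * \<tau> ^ r) * (2 * real (Suc r) * s ^ r)"
      using C \<tau>0 by (intro mult_mono) auto
    thus ?thesis using True by (simp add: f_def norm_mult K_def power_mult_distrib algebra_simps)
  next
    case False
    thus ?thesis using C \<tau>0 s by (simp add: f_def K_def)
  qed
  have f_AE: "AE x in M. f r x = c r * of_real (X_fun r q x)" for r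
    using M_supp by eventually_elim (auto simp: f_def abs_le_iff)
  have [measurable]: "(\<lambda>x. poly P x) \<in> borel_measurable M" for P
    using M_poly(1) by (rule borel_measurable_integrable)
  have X_meas: "(\<lambda>x. c r * complex_of_real (X_fun r q x)) \<in> borel_measurable M" for r
    unfolding X_fun_eq_poly by measurable
  have f_meas: "f r \<in> borel_measurable M" for r
    unfolding f_def X_fun_eq_poly by measurable
  have f_int: "integrable M (f r)" for r
    by (rule M.integrable_const_bound[of _ "K r"]) (use f_le f_meas in auto)
  have f_integral: "integral\<^sup>L M (f r) = c r * of_real (L (X_poly q r))" for r
  proof -
    have "integral\<^sup>L M (f r) = (\<integral>x. c r * of_real (X_fun r q x) \<partial>M)"
      by (rule integral_cong_AE[OF f_meas X_meas f_AE])
    also have "\<dots> = c r * (\<integral>x. of_real (poly (X_poly q r) x) \<partial>M)"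
      unfolding X_fun_eq_poly by simp
    also have "\<dots> = c r * of_real (L (X_poly q r))"
      by (simp only: integral_complex_of_real M_poly)
    finally show ?thesis .
  qed
  have f_summable: "summable (\<lambda>r. norm (f r x))" for x
    by (rule summable_comparison_test'[OF K_summable, of 0]) (use f_le in auto)
  have "norm (\<integral>x. norm (f r x) \<partial>M) \<le> K r" for r
  proof -
    have "(\<integral>x. norm (f r x) \<partial>M) \<le> (\<integral>x. K r \<partial>M)"
      by (rule integral_mono) (use f_int f_le in auto)
    thus ?thesis using M.prob_space by (simp add: integral_nonneg_AE)
  qed
  hence "summable (\<lambda>r. \<integral>x. norm (f r x) \<partial>M)"
    by (intro summable_comparison_test'[OF K_summable, of 0]) auto
  hence "(\<lambda>r. integral\<^sup>L M (f r)) sums (\<integral>x. (\<Sum>r. f r x) \<partial>M)"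
    by (intro sums_integral f_int) (use f_summable in auto)
  also have "(\<integral>x. (\<Sum>r. f r x) \<partial>M) = (LINT x:Omega_real \<rho>|M. h (of_real x))"
    unfolding set_lebesgue_integral_def
  proof (rule integral_cong_AE)
    show "AE x in M. (\<Sum>r. f r x) = indicator (Omega_real \<rho>) x *\<^sub>R h (of_real x)"
      using M_supp
    proof eventually_elim
      case (elim x)
      hence "(\<lambda>r. c r * of_real (X_fun r q x)) sums h (of_real x)"
        unfolding c_def using X_fun_expansion[OF q \<rho> h \<tau>(1), of x] \<tau>(2) by (simp add: s_def R)
      moreover have "x \<in> {-R..R}" using elim by auto
      ultimately show ?case using Omega_real[OF elim] by (simp add: f_def sums_iff)
    qed
    show "(\<lambda>x. \<Sum>r. f r x) \<in> borel_measurable M"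
      by (intro borel_measurable_suminf f_meas)
  qed (use h_meas in simp)
  finally have "(\<lambda>r. c r * of_real (L (X_poly q r))) sums (LINT x:Omega_real \<rho>|M. h (of_real x))"
    unfolding f_integral .
  hence main: "(\<lambda>n. c (Suc n) * of_real (L (X_poly q (Suc n)))) sums
      ((LINT x:Omega_real \<rho>|M. h (of_real x)) - c 0)"
    using sums_Suc_iff[of "\<lambda>r. c r * of_real (L (X_poly q r))"] L_1 by simp
  have term_eq: "of_real (real q powr (- real (Suc n) / 2)) * a_coeff (Suc n) q h
                 * of_nat (num_closed_nb_walks G arev (Suc n) v)
      = c (Suc n) * of_real (L (X_poly q (Suc n)))" for n
  proof -
    have "real q powr (- real (Suc n) / 2) = s powr (- real (Suc n))"
      using q by (simp add: s_def powr_half_sqrt[symmetric] powr_powr)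
    also have "\<dots> = inverse (s ^ Suc n)" using s by (subst powr_minus) (simp only: powr_realpow)
    finally have powr: "real q powr (- real (Suc n) / 2) = inverse (s ^ Suc n)" .
    have nz: "s ^ Suc n \<noteq> 0" using s by simp
    have "real q powr (- real (Suc n) / 2) * real (num_closed_nb_walks G arev (Suc n) v) = L (X_poly q (Suc n))"
      unfolding num_closed_nb_walks_eq s_def[symmetric] powr
      by (simp only: mult.assoc[symmetric] left_inverse[OF nz] mult_1)
    thus ?thesis unfolding c_Suc
      by (metis (no_types, lifting) mult.assoc mult.commute of_real_mult of_real_of_nat_eq)
  qed
  show ?thesis
    unfolding term_eq M_def[symmetric] N_def[symmetric]
    using goal1 goal2 goal3 goal4 main c_0 by (auto simp: sums_iff)
qed

end
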